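(* Let $J\subset\mathbb{R}$ be a bounded open interval, $x_0\in\overline{J}$, and let $f\in W^{1,2}(J)$ be complex-valued with $f(x)\neq0$ for all $x\in\overline{J}$ and $f(x_0)=1$. Then the following factorization holds in the distributional sense: $$\mathbf{S}_f y=-\frac1f D f^2 D\frac{y}{f}\qquad\forall y\in\mathscr{D}_2(\mathbf{S}_f),$$ or, equivalently, $\mathbf{S}_f y=f\,\mathbf{L}_f\!\left[\frac{y}{f}\right]$ for all $y\in\mathscr{D}_2(\mathbf{S}_f)$.
   Context: All functions are complex-valued; $D=\frac{d}{dx}$ (distributional). $W^{-1,2}(J)$ is the topological dual of $W_0^{1,2}(J)$ with (bilinear) action $(\cdot|\cdot)$. The distribution $q_f=\frac{f''}{f}\in W^{-1,2}(J)$ is given by $(q_f|\phi)=\int_J\{(f'/f)^2\phi-(f'/f)\phi'\}\,dx$ for $\phi\in W^{1,2}_0(J)$. For $y\in W^{1,2}(J)$, $\mathbf{S}_f y=-y''+q_f y\in W^{-1,2}(J)$ is defined by $(\mathbf{S}_f y|\phi)=\int_J y'\phi'\,dx+(q_f|y\phi)$, $\phi\in W^{1,2}_0(J)$. $\mathscr{D}_2(\mathbf{S}_f)$ is the set of $y\in W^{1,2}(J)$ such that $\mathbf{S}_f y$ is $L^2$-regular, i.e. $(\mathbf{S}_f y|\phi)=\int_J g\phi\,dx$ for all $\phi$ for some $g\in L^2(J)$; one then writes $\mathbf{S}_f y=g$. The impedance operator is $\mathbf{L}_f v=-\frac1{f^2}Df^2Dv=-v''-\frac{2f'}{f}v'$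 for $v\in W^{2,1}(J)$. *)

theory Defs
  imports "HOL-Analysis.Analysis"
begin

text \<open>
  Elements of the function spaces below are representatives \<open>real \<Rightarrow> complex\<close> rather than classes
  modulo null sets; only the values on \<open>J\<close>, up to a null set, matter.
\<close>

definition test_fun :: "real set \<Rightarrow> (real \<Rightarrow> complex) set" where
  "test_fun J = {\<phi>. (\<forall>n. ((\<lambda>g x. vector_derivative g (at x)) ^^ n) \<phi> differentiable_on UNIV) \<and>
     compact (closure {x. \<phi> x \<noteq> 0}) \<and> closure {x. \<phi> x \<noteq> 0} \<subseteq> J}"

definition locally_integrable :: "real set \<Rightarrow> (real \<Rightarrow> complex) \<Rightarrow> bool" where
  "locally_integrable J u \<longleftrightarrow> (\<forall>K\<subseteq>J. compact K \<longrightarrow> integrable (lebesgue_on K) u)"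

definition has_weak_deriv :: "real set \<Rightarrow> (real \<Rightarrow> complex) \<Rightarrow> (real \<Rightarrow> complex) \<Rightarrow> bool" where
  "has_weak_deriv J u w \<longleftrightarrow> locally_integrable J u \<and> locally_integrable J w \<and>
     (\<forall>\<phi>\<in>test_fun J. (LINT x|lebesgue_on J. u x * vector_derivative \<phi> (at x)) =
                    - (LINT x|lebesgue_on J. w x * \<phi> x))"

text \<open>The choice is unique up to a null set; the value is arbitrary if no weak derivative exists.\<close>

definition wderiv :: "real set \<Rightarrow> (real \<Rightarrow> complex) \<Rightarrow> real \<Rightarrow> complex" where
  "wderiv J u = (SOME w. has_weak_deriv J u w)"

definition Lp :: "nat \<Rightarrow> real set \<Rightarrow> (real \<Rightarrow> complex) set" where
  "Lp p J = {u \<in> borel_measurable (lebesgue_on J). integrable (lebesgue_on J) (\<lambda>x. cmod (u x) ^ p)}"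

primrec sobolev :: "nat \<Rightarrow> nat \<Rightarrow> real set \<Rightarrow> (real \<Rightarrow> complex) set" where
  "sobolev 0 p J = Lp p J"
| "sobolev (Suc k) p J = {u \<in> Lp p J. \<exists>w\<in>sobolev k p J. has_weak_deriv J u w}"

definition sobolev_norm12 :: "real set \<Rightarrow> (real \<Rightarrow> complex) \<Rightarrow> real" where
  "sobolev_norm12 J u = sqrt ((LINT x|lebesgue_on J. (cmod (u x))\<^sup>2) +
                              (LINT x|lebesgue_on J. (cmod (wderiv J u x))\<^sup>2))"

text \<open>\<open>W\<^sub>0\<^sup>1\<^sup>,\<^sup>2(J)\<close>: the closure of the test functions in \<open>W\<^sup>1\<^sup>,\<^sup>2(J)\<close>.\<close>

definition sobolev12_0 :: "real set \<Rightarrow> (real \<Rightarrow> complex) set" where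
  "sobolev12_0 J = {u \<in> sobolev 1 2 J.
     \<forall>e>0. \<exists>\<phi>\<in>test_fun J. sobolev_norm12 J (\<lambda>x. u x - \<phi> x) < e}"

text \<open>
  An element of \<open>W\<^sup>-\<^sup>1\<^sup>,\<^sup>2(J)\<close> is given by its action \<open>T\<close> on \<open>sobolev12_0 J\<close>; values of \<open>T\<close> on other
  functions are irrelevant, so equality in \<open>W\<^sup>-\<^sup>1\<^sup>,\<^sup>2(J)\<close> is equality on \<open>sobolev12_0 J\<close>.
\<close>

type_synonym functional = "(real \<Rightarrow> complex) \<Rightarrow> complex"

definition dist_eq :: "real set \<Rightarrow> functional \<Rightarrow> functional \<Rightarrow> bool" where
  "dist_eq J S T \<longleftrightarrow> (\<forall>\<phi>\<in>sobolev12_0 J. S \<phi> = T \<phi>)"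

definition dist_of_fun :: "real set \<Rightarrow> (real \<Rightarrow> complex) \<Rightarrow> functional" where
  "dist_of_fun J g = (\<lambda>\<phi>. LINT x|lebesgue_on J. g x * \<phi> x)"

text \<open>The distributional derivative of \<open>h \<in> L\<^sup>2(J)\<close> as an element of \<open>W\<^sup>-\<^sup>1\<^sup>,\<^sup>2(J)\<close>.\<close>

definition dist_deriv :: "real set \<Rightarrow> (real \<Rightarrow> complex) \<Rightarrow> functional" where
  "dist_deriv J h = (\<lambda>\<phi>. - (LINT x|lebesgue_on J. h x * wderiv J \<phi> x))"

text \<open>Product of \<open>u \<in> W\<^sup>1\<^sup>,\<^sup>2(J)\<close> with \<open>T \<in> W\<^sup>-\<^sup>1\<^sup>,\<^sup>2(J)\<close>.\<close>

definition dist_mult :: "(real \<Rightarrow> complex) \<Rightarrow> functional \<Rightarrow> functional" where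
  "dist_mult u T = (\<lambda>\<phi>. T (\<lambda>x. u x * \<phi> x))"

definition L2_regular :: "real set \<Rightarrow> functional \<Rightarrow> (real \<Rightarrow> complex) \<Rightarrow> bool" where
  "L2_regular J T g \<longleftrightarrow> g \<in> Lp 2 J \<and> dist_eq J T (dist_of_fun J g)"

text \<open>The distribution \<open>f'' / f\<close>.\<close>

definition q_dist :: "real set \<Rightarrow> (real \<Rightarrow> complex) \<Rightarrow> functional" where
  "q_dist J f = (\<lambda>\<phi>. LINT x|lebesgue_on J.
     (wderiv J f x / f x)\<^sup>2 * \<phi> x - (wderiv J f x / f x) * wderiv J \<phi> x)"

definition schroedinger :: "real set \<Rightarrow> (real \<Rightarrow> complex) \<Rightarrow> (real \<Rightarrow> complex) \<Rightarrow> functional" where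
  "schroedinger J f y = (\<lambda>\<phi>. (LINT x|lebesgue_on J. wderiv J y x * wderiv J \<phi> x)
                              + q_dist J f (\<lambda>x. y x * \<phi> x))"

definition domain2 :: "real set \<Rightarrow> (real \<Rightarrow> complex) \<Rightarrow> (real \<Rightarrow> complex) set" where
  "domain2 J f = {y \<in> sobolev 1 2 J. \<exists>g. L2_regular J (schroedinger J f y) g}"

definition impedance :: "real set \<Rightarrow> (real \<Rightarrow> complex) \<Rightarrow> (real \<Rightarrow> complex) \<Rightarrow> real \<Rightarrow> complex" where
  "impedance J f v = (\<lambda>x. - (1 / (f x)\<^sup>2) * wderiv J (\<lambda>t. (f t)\<^sup>2 * wderiv J v t) x)"

end

theory Submission
  imports Defs
begin

text \<open>
  A function in \<open>W\<^sup>1\<^sup>,\<^sup>2(a, b)\<close> is almost everywhere equal to a primitive of its weak derivative (du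
  Bois-Reymond), and such primitives obey the product and reciprocal rules. Hence, with
  \<open>h = f\<^sup>2 (y/f)' = f y' - f' y\<close>, the identity \<open>(S\<^sub>f y|\<phi>) = \<integral> h (\<phi>/f)'\<close> holds because the two integrands agree
  almost everywhere. If \<open>S\<^sub>f y = g\<close>, testing with \<open>\<phi> = f \<psi>\<close> for a test function \<open>\<psi>\<close> gives
  \<open>\<integral> h \<psi>' = \<integral> g f \<psi>\<close>, that is, \<open>h' = - g f\<close> weakly. So \<open>(y/f)' = h/f\<^sup>2\<close> is again a Sobolev function and
  \<open>-(1/f) h' = g\<close>. That \<open>f \<psi>\<close> is admissible, i.e. belongs to \<open>W\<^sub>0\<^sup>1\<^sup>,\<^sup>2\<close>, rests on the density of the test
  functions in \<open>L\<^sup>2\<close>.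
\<close>

section \<open>Smooth functions of a real variable\<close>

text \<open>With q = f'/f the integrand of \<open>(S_f y|\<phi>)\<close> is (y' - q y)(\<phi>' - q
  \<phi>): the weak definition of f''/f supplies exactly the terms that complete this product, so no
  second derivative of f occurs. As y' - q y = f (y/f)' and likewise for \<phi>, the product is f^2
  (y/f)' (\<phi>/f)', and \<phi> = f \<psi> is the choice that turns the last factor into \<psi>'.
  Two obstacles shape the rest. Elements of Sobolev spaces are representatives and
  \<open>wderiv\<close> is an unspecified choice, so identities hold only almost everywhere; all
  calculations use absolutely continuous representatives and are transferred afterwards. The
  function f is the exception: being continuous on the closed interval it is its own representative,
  so its pointwise nonvanishing bounds 1/f. Moreover the space of admissible \<phi> is a norm
  closure and f \<psi> is not smooth: its derivative is approximated in the mean square by a test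
  function, the mean of that function is corrected to zero, and the result is integrated.\<close>

definition smooth_upto :: "nat \<Rightarrow> (real \<Rightarrow> complex) \<Rightarrow> bool" where
  "smooth_upto n u \<longleftrightarrow> (\<forall>k<n. ((\<lambda>g x. vector_derivative g (at x)) ^^ k) u differentiable_on UNIV)"

lemma smooth_upto_0 [simp]: "smooth_upto 0 u"
  by (simp add: smooth_upto_def)

text \<open>Peeling off the innermost derivative reduces order n + 1 of u to order n of u'. This is
  what lets the closure properties below go by induction on the order with u arbitrary; the
  condition in \<open>test_fun\<close>, which concerns all orders at once, offers no such
  induction.\<close>

lemma smooth_upto_Suc_iff:
  "smooth_upto (Suc n) u \<longleftrightarrow>
    u differentiable_on UNIV \<and> smooth_upto n (\<lambda>x. vector_derivative u (at x))"
  unfolding smooth_upto_def All_less_Suc2 funpow_Suc_right o_apply funpow_0 ..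

lemma smooth_upto_SucI:
  assumes "\<And>x. (u has_vector_derivative u' x) (at x)" "smooth_upto n u'"
  shows "smooth_upto (Suc n) u"
proof -
  have "(\<lambda>x. vector_derivative u (at x)) = u'"
    using assms(1) vector_derivative_at by blast
  moreover have "u differentiable_on UNIV"
    using assms(1) by (meson differentiableI_vector differentiable_at_imp_differentiable_on)
  ultimately show ?thesis
    using assms(2) by (simp add: smooth_upto_Suc_iff)
qed

lemma smooth_upto_SucE:
  assumes "smooth_upto (Suc n) u"
  obtains u' where "\<And>x. (u has_vector_derivative u' x) (at x)" "smooth_upto n u'"
proof
  show "(u has_vector_derivative vector_derivative u (at x)) (at x)" for x
    using assms by (simp add: smooth_upto_Suc_iff differentiable_on_def vector_derivative_works)
  show "smooth_upto n (\<lambda>x. vector_derivative u (at x))"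
    using assms by (simp add: smooth_upto_Suc_iff)
qed

lemma smooth_upto_Suc: "smooth_upto (Suc n) u \<Longrightarrow> smooth_upto n u"
  by (simp add: smooth_upto_def)

lemma smooth_upto_add:
  "smooth_upto n u \<Longrightarrow> smooth_upto n v \<Longrightarrow> smooth_upto n (\<lambda>x. u x + v x)"
proof (induction n arbitrary: u v)
  case (Suc n)
  obtain u' v' where "\<And>x. (u has_vector_derivative u' x) (at x)" "smooth_upto n u'"
    "\<And>x. (v has_vector_derivative v' x) (at x)" "smooth_upto n v'"
    using Suc.prems by (metis smooth_upto_SucE)
  then show ?case
    by (intro smooth_upto_SucI[where u' = "\<lambda>x. u' x + v' x"] derivative_intros Suc.IH)
qed simp

lemma smooth_upto_const: "smooth_upto n (\<lambda>x. c)"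
proof (induction n arbitrary: c)
  case (Suc n)
  then show ?case
    by (intro smooth_upto_SucI[where u' = "\<lambda>x. 0"] derivative_intros)
qed simp

lemma smooth_upto_mult:
  "smooth_upto n u \<Longrightarrow> smooth_upto n v \<Longrightarrow> smooth_upto n (\<lambda>x. u x * v x)"
proof (induction n arbitrary: u v)
  case (Suc n)
  obtain u' v' where "\<And>x. (u has_vector_derivative u' x) (at x)" "smooth_upto n u'"
    "\<And>x. (v has_vector_derivative v' x) (at x)" "smooth_upto n v'"
    using Suc.prems by (metis smooth_upto_SucE)
  then show ?case
    using Suc.prems[THEN smooth_upto_Suc]
    by (intro smooth_upto_SucI[where u' = "\<lambda>x. u x * v' x + u' x * v x"]
        has_vector_derivative_mult smooth_upto_add Suc.IH)
qed simp

lemma smooth_upto_affine: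
  "smooth_upto n u \<Longrightarrow> smooth_upto n (\<lambda>x. u (\<alpha> * x + \<beta>))"
proof (induction n arbitrary: u)
  case (Suc n)
  obtain u' where u': "\<And>x. (u has_vector_derivative u' x) (at x)" "smooth_upto n u'"
    using Suc.prems by (metis smooth_upto_SucE)
  have "((\<lambda>x. u (\<alpha> * x + \<beta>)) has_vector_derivative complex_of_real \<alpha> * u' (\<alpha> * x + \<beta>)) (at x)" for x
  proof -
    have "((\<lambda>x. \<alpha> * x + \<beta>) has_vector_derivative \<alpha>) (at x)"
      by (auto intro!: derivative_eq_intros)
    from vector_diff_chain_at[OF this u'(1)] show ?thesis
      by (simp add: o_def scaleR_conv_of_real)
  qed
  then show ?case
    by (rule smooth_upto_SucI) (intro smooth_upto_mult smooth_upto_const Suc.IH u'(2))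
qed simp

definition smooth :: "(real \<Rightarrow> complex) \<Rightarrow> bool" where
  "smooth u \<longleftrightarrow> (\<forall>n. smooth_upto n u)"

lemma smooth_iff:
  "smooth u \<longleftrightarrow> (\<forall>n. ((\<lambda>g x. vector_derivative g (at x)) ^^ n) u differentiable_on UNIV)"
  by (auto simp: smooth_def smooth_upto_def)

lemma smooth_add: "smooth u \<Longrightarrow> smooth v \<Longrightarrow> smooth (\<lambda>x. u x + v x)"
  by (simp add: smooth_def smooth_upto_add)

lemma smooth_const: "smooth (\<lambda>x. c)"
  by (simp add: smooth_def smooth_upto_const)

lemma smooth_mult: "smooth u \<Longrightarrow> smooth v \<Longrightarrow> smooth (\<lambda>x. u x * v x)"
  by (simp add: smooth_def smooth_upto_mult)

lemma smooth_affine: "smooth u \<Longrightarrow> smooth (\<lambda>x. u (\<alpha> * x + \<beta>))"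
  by (simp add: smooth_def smooth_upto_affine)

lemma smoothI:
  assumes "\<And>x. (u has_vector_derivative u' x) (at x)" "smooth u'"
  shows "smooth u"
  unfolding smooth_def
proof
  fix n
  show "smooth_upto n u"
    using assms by (cases n) (auto simp: smooth_def intro: smooth_upto_SucI)
qed

lemma smooth_has_vector_derivative:
  "smooth u \<Longrightarrow> (u has_vector_derivative vector_derivative u (at x)) (at x)"
  using smooth_upto_Suc_iff[of 0 u]
  by (auto simp: smooth_def differentiable_on_def vector_derivative_works)

lemma smooth_vector_derivative: "smooth u \<Longrightarrow> smooth (\<lambda>x. vector_derivative u (at x))"
  using smooth_upto_Suc_iff by (auto simp: smooth_def)

lemma smooth_continuous_on: "smooth u \<Longrightarrow> continuous_on S u"
  by (meson smooth_has_vector_derivative continuous_at_imp_continuous_on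
      has_vector_derivative_continuous)

section \<open>A smooth step function built from exp(-1/t)\<close>

text \<open>Only k = 0 is needed as a function; the powers of 1/t are there because the whole family
  is closed under differentiation up to linear combinations, so that smoothness follows for all k
  simultaneously.\<close>

definition flat_exp :: "nat \<Rightarrow> real \<Rightarrow> real" where
  "flat_exp k t = (if t > 0 then (1 / t) ^ k * exp (- (1 / t)) else 0)"

lemma flat_exp_DERIV:
  "(flat_exp k has_real_derivative (flat_exp (k + 2) t - real k * flat_exp (k + 1) t)) (at t)"
proof -
  consider "t > 0" | "t < 0" | "t = 0" by linarith
  then show ?thesis
  proof cases
    case 1
    have G: "((\<lambda>s. s ^ k * exp (- s)) has_real_derivative
        (real k * s ^ (k - 1) - s ^ k) * exp (- s)) (at s)" for s :: real
      by (auto intro!: derivative_eq_intros simp: algebra_simps)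
    have "((\<lambda>t. 1 / t) has_real_derivative - ((1 / t)\<^sup>2)) (at t)"
      using 1 by (auto intro!: derivative_eq_intros simp: power2_eq_square)
    from DERIV_chain2[OF G this]
    have "((\<lambda>t. (1 / t) ^ k * exp (- (1 / t))) has_real_derivative
        (real k * (1 / t) ^ (k - 1) - (1 / t) ^ k) * exp (- (1 / t)) * - ((1 / t)\<^sup>2)) (at t)" .
    also have "(real k * s ^ (k - 1) - s ^ k) * exp (- s) * - (s\<^sup>2)
        = s ^ (k + 2) * exp (- s) - real k * (s ^ (k + 1) * exp (- s))" for s :: real
      by (cases k) (auto simp: algebra_simps power2_eq_square)
    also have "(1 / t) ^ (k + 2) * exp (- (1 / t)) - real k * ((1 / t) ^ (k + 1) * exp (- (1 / t)))
        = flat_exp (k + 2) t - real k * flat_exp (k + 1) t"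
      using 1 by (simp add: flat_exp_def)
    finally have "((\<lambda>t. (1 / t) ^ k * exp (- (1 / t))) has_real_derivative
        (flat_exp (k + 2) t - real k * flat_exp (k + 1) t)) (at t)" .
    then show ?thesis
      by (rule has_field_derivative_transform_within_open[where S = "{0<..}"])
        (use 1 in \<open>auto simp: flat_exp_def\<close>)
  next
    case 2
    have "((\<lambda>t. 0) has_real_derivative (flat_exp (k + 2) t - real k * flat_exp (k + 1) t)) (at t)"
      using 2 by (simp add: flat_exp_def)
    then show ?thesis
      by (rule has_field_derivative_transform_within_open[where S = "{..<0}"])
        (use 2 in \<open>auto simp: flat_exp_def\<close>)
  next
    case 3
    \<comment> \<open>With s = 1/t the difference quotient at 0 from the right is s^(k+1) / exp s,
      which vanishes as s tends to infinity; from the left it is identically 0.\<close>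
    have "((\<lambda>x::real. x ^ (k + 1) / exp x) \<longlongrightarrow> 0) at_top"
      by (rule tendsto_power_div_exp_0)
    then have "((\<lambda>t::real. inverse t ^ (k + 1) / exp (inverse t)) \<longlongrightarrow> 0) (at_right 0)"
      by (rule filterlim_compose[OF _ filterlim_inverse_at_top_right])
    then have "((\<lambda>h. (flat_exp k (0 + h) - flat_exp k 0) / h) \<longlongrightarrow> 0) (at_right 0)"
      by (rule Lim_transform_eventually)
        (auto simp: flat_exp_def eventually_at_filter exp_minus field_simps)
    moreover have "((\<lambda>h. (flat_exp k (0 + h) - flat_exp k 0) / h) \<longlongrightarrow> 0) (at_left 0)"
      by (rule Lim_transform_eventually[OF tendsto_const])
        (auto simp: flat_exp_def eventually_at_filter)
    ultimately have "((\<lambda>h. (flat_exp k (0 + h) - flat_exp k 0) / h) \<longlongrightarrow> 0) (at 0)"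
      by (simp add: filterlim_split_at)
    then show ?thesis
      using 3 by (simp add: DERIV_def flat_exp_def)
  qed
qed

lemma smooth_flat_exp: "smooth (\<lambda>t. of_real (flat_exp k t))"
  unfolding smooth_def
proof
  fix n
  show "smooth_upto n (\<lambda>t. of_real (flat_exp k t))"
  proof (induction n arbitrary: k)
    case (Suc n)
    have "((\<lambda>t. complex_of_real (flat_exp k t)) has_vector_derivative
       of_real (flat_exp (k + 2) t) + of_real (- real k) * of_real (flat_exp (k + 1) t)) (at t)" for t
      using has_vector_derivative_of_real[OF flat_exp_DERIV[of k t]] by simp
    then show ?case
      by (rule smooth_upto_SucI) (intro smooth_upto_add smooth_upto_mult smooth_upto_const Suc.IH)
  qed simp
qed

text \<open>For x < c the term \<open>integral {c..x} \<beta>\<close> is an integral over the empty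
  set, not a signed integral. Since \<beta> vanishes up to c this does no harm, and the derivative
  exists from both sides, also at c.\<close>

lemma has_vector_derivative_primitive:
  fixes \<beta> :: "real \<Rightarrow> complex"
  assumes "continuous_on UNIV \<beta>" and "\<And>x. x \<le> c \<Longrightarrow> \<beta> x = 0"
  shows "((\<lambda>x. integral {c..x} \<beta>) has_vector_derivative \<beta> x) (at x)"
proof (cases "x < c")
  case True
  have "((\<lambda>x. 0) has_vector_derivative \<beta> x) (at x)"
    using True assms(2) by simp
  then show ?thesis
    by (rule has_vector_derivative_transform_within_open[where S = "{..<c}"]) (use True in auto)
next
  case False
  \<comment> \<open>Lowering the limit to c - 1 makes x, which may equal c, an interior point; the
    added piece contributes 0.\<close>
  have "((\<lambda>x. integral {c-1..x} \<beta>) has_vector_derivative \<beta> x) (at x within {c-1..x+1})"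
    by (rule integral_has_vector_derivative)
      (use False assms(1) in \<open>auto intro: continuous_on_subset\<close>)
  then have *: "((\<lambda>x. integral {c-1..x} \<beta>) has_vector_derivative \<beta> x) (at x)"
    using False at_within_Icc_at[of "c-1" x "x+1"] by simp
  have 0: "integral {c-1..d} \<beta> = 0" if "d \<le> c" for d
  proof -
    have "integral {c-1..d} \<beta> = integral {c-1..d} (\<lambda>x. 0)"
      using that assms(2) by (intro integral_cong) auto
    then show ?thesis by simp
  qed
  have "integral {c-1..t} \<beta> = integral {c..t} \<beta>" for t
  proof (cases "t < c")
    case True
    then show ?thesis by (simp add: 0)
  next
    case False
    have "integral {c-1..c} \<beta> + integral {c..t} \<beta> = integral {c-1..t} \<beta>"
      by (rule Henstock_Kurzweil_Integration.integral_combine)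
        (use False assms(1) in \<open>auto intro!: integrable_continuous_real intro: continuous_on_subset\<close>)
    then show ?thesis by (simp add: 0)
  qed
  with * show ?thesis by simp
qed

lemma smooth_primitive:
  assumes "smooth \<beta>" "\<And>x. x \<le> c \<Longrightarrow> \<beta> x = 0"
  shows "smooth (\<lambda>x. integral {c..x} \<beta>)"
  using has_vector_derivative_primitive[OF smooth_continuous_on[OF assms(1)] assms(2)] assms(1)
  by (rule smoothI)

text \<open>B is the primitive, normalised by its total mass, of the bump exp(-1/t) exp(-1/(1-t)) on
  (0, 1).\<close>

lemma smooth_step:
  obtains B :: "real \<Rightarrow> complex" where "smooth B" "\<And>x. cmod (B x) \<le> 1"
    "\<And>x. x \<le> 0 \<Longrightarrow> B x = 0" "\<And>x. x \<ge> 1 \<Longrightarrow> B x = 1"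
proof -
  define r where "r = (\<lambda>t. flat_exp 0 t * flat_exp 0 (1 - t))"
  define \<beta> where "\<beta> = (\<lambda>t. complex_of_real (r t))"
  define c where "c = integral {0..1} r"
  define B where "B = (\<lambda>x. (1 / of_real c) * integral {0..x} \<beta>)"
  have r0: "r t \<ge> 0" "t \<notin> {0<..<1} \<Longrightarrow> r t = 0" for t
    by (auto simp: r_def flat_exp_def)
  have "smooth (\<lambda>t. of_real (flat_exp 0 t) * of_real (flat_exp 0 (- 1 * t + 1)))"
    by (intro smooth_mult smooth_flat_exp smooth_affine[of "\<lambda>t. of_real (flat_exp 0 t)"])
  then have sm: "smooth \<beta>"
    by (simp add: \<beta>_def r_def)
  have cont: "continuous_on S r" for S
    using smooth_continuous_on[OF sm, THEN continuous_on_Re] by (simp add: \<beta>_def)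
  have int: "r integrable_on {x..y}" for x y
    by (rule integrable_continuous_real[OF cont])
  have I: "integral {x..y} \<beta> = of_real (integral {x..y} r)" for x y
    using integral_linear[OF int bounded_linear_of_real[where 'a = complex], of x y]
    by (simp add: \<beta>_def o_def)
  have "c \<noteq> 0"
  proof
    assume "c = 0"
    then have "r (1/2) = 0"
      using integral_eq_0_iff[OF cont, of 0 1] r0 by (auto simp: c_def)
    then show False by (simp add: r_def flat_exp_def)
  qed
  moreover have "c \<ge> 0"
    unfolding c_def using r0 int by (intro Henstock_Kurzweil_Integration.integral_nonneg) auto
  ultimately have c: "c > 0" by simp
  have ge1: "integral {0..x} r = c" if "x \<ge> 1" for x
  proof -
    have "integral {1..x} r = integral {1..x} (\<lambda>x. 0)"
      by (rule integral_cong) (use r0 in auto)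
    moreover have "integral {0..1} r + integral {1..x} r = integral {0..x} r"
      by (rule Henstock_Kurzweil_Integration.integral_combine) (use that int in auto)
    ultimately show ?thesis by (simp add: c_def)
  qed
  show thesis
  proof
    show "smooth B"
      unfolding B_def
      by (intro smooth_mult smooth_const smooth_primitive sm) (use r0 in \<open>auto simp: \<beta>_def\<close>)
    show "B x = 1" if "x \<ge> 1" for x
      using c ge1[OF that] by (simp add: B_def I)
    show B0: "B x = 0" if "x \<le> 0" for x
    proof -
      have "integral {0..x} \<beta> = 0"
        using that by (cases "x = 0") auto
      then show ?thesis by (simp add: B_def)
    qed
    show "cmod (B x) \<le> 1" for x
    proof -
      have "integral {0..x} r \<ge> 0"
        using r0 int by (intro Henstock_Kurzweil_Integration.integral_nonneg) auto
      moreover have "integral {0..x} r \<le> integral {0..max x 1} r"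
        using r0 int by (intro integral_subset_le) auto
      ultimately show ?thesis
        using c ge1[of "max x 1"] by (simp add: B_def I norm_mult norm_divide)
    qed
  qed
qed

section \<open>Test functions\<close>

lemma test_funI:
  assumes "smooth \<phi>" "\<And>x. \<phi> x \<noteq> 0 \<Longrightarrow> x \<in> {c..d}" "{c..d} \<subseteq> J"
  shows "\<phi> \<in> test_fun J"
proof -
  have "closure {x. \<phi> x \<noteq> 0} \<subseteq> {c..d}"
    using assms(2) by (intro closure_minimal) auto
  moreover from this have "compact (closure {x. \<phi> x \<noteq> 0})"
    by (meson bounded_closed_interval bounded_subset closed_closure compact_eq_bounded_closed)
  ultimately show ?thesis
    using assms by (auto simp: test_fun_def smooth_iff)
qed

lemma test_fun_smooth: "\<phi> \<in> test_fun J \<Longrightarrow> smooth \<phi>"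
  by (simp add: test_fun_def smooth_iff)

text \<open>The support is enclosed in a nonempty compact interval even for \<phi> = 0, so later
  uses need no case distinction.\<close>

lemma test_fun_support:
  assumes "\<phi> \<in> test_fun {a<..<b}" "a < b"
  obtains c d where "a < c" "c \<le> d" "d < b" "\<And>x. \<phi> x \<noteq> 0 \<Longrightarrow> x \<in> {c..d}"
proof (cases "closure {x. \<phi> x \<noteq> 0} = {}")
  case True
  then have "\<And>x. \<phi> x = 0" by auto
  then show ?thesis
    using that[of "(a+b)/2" "(a+b)/2"] assms(2) by auto
next
  case False
  let ?K = "closure {x. \<phi> x \<noteq> 0}"
  have K: "compact ?K" "?K \<subseteq> {a<..<b}"
    using assms by (auto simp: test_fun_def)
  obtain c where c: "c \<in> ?K" "\<And>x. x \<in> ?K \<Longrightarrow> c \<le> x"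
    using compact_attains_inf[OF K(1) False] by blast
  obtain d where d: "d \<in> ?K" "\<And>x. x \<in> ?K \<Longrightarrow> x \<le> d"
    using compact_attains_sup[OF K(1) False] by blast
  show ?thesis
  proof (rule that[of c d])
    show "\<phi> x \<noteq> 0 \<Longrightarrow> x \<in> {c..d}" for x
      using c(2)[of x] d(2)[of x] closure_subset[of "{x. \<phi> x \<noteq> 0}"] by auto
  qed (use c d K(2) in auto)
qed

lemma test_fun_add:
  assumes "\<phi> \<in> test_fun {a<..<b}" "\<psi> \<in> test_fun {a<..<b}" "a < b"
  shows "(\<lambda>x. \<phi> x + \<psi> x) \<in> test_fun {a<..<b}"
proof -
  obtain c d where 1: "a < c" "c \<le> d" "d < b" "\<And>x. \<phi> x \<noteq> 0 \<Longrightarrow> x \<in> {c..d}"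
    using test_fun_support assms by metis
  obtain c' d' where 2: "a < c'" "c' \<le> d'" "d' < b" "\<And>x. \<psi> x \<noteq> 0 \<Longrightarrow> x \<in> {c'..d'}"
    using test_fun_support assms by metis
  show ?thesis
  proof (rule test_funI)
    show "x \<in> {min c c'..max d d'}" if "\<phi> x + \<psi> x \<noteq> 0" for x
    proof -
      have "\<phi> x \<noteq> 0 \<or> \<psi> x \<noteq> 0" using that by auto
      then show ?thesis using 1(4)[of x] 2(4)[of x] by auto
    qed
  qed (use 1 2 assms test_fun_smooth smooth_add in auto)
qed

lemma test_fun_mult:
  assumes "\<phi> \<in> test_fun {a<..<b}" "smooth \<psi>" "a < b"
  shows "(\<lambda>x. \<psi> x * \<phi> x) \<in> test_fun {a<..<b}"
proof -
  obtain c d where 1: "a < c" "c \<le> d" "d < b" "\<And>x. \<phi> x \<noteq> 0 \<Longrightarrow> x \<in> {c..d}"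
    using test_fun_support assms by metis
  show ?thesis
    by (rule test_funI[of _ c d]) (use 1 assms test_fun_smooth smooth_mult in auto)
qed

lemma test_fun_subset: "\<phi> \<in> test_fun A \<Longrightarrow> A \<subseteq> B \<Longrightarrow> \<phi> \<in> test_fun B"
  by (auto simp: test_fun_def)

text \<open>To the right of the support of \<phi> the primitive is constant, and the zero mean makes
  that constant 0.\<close>

lemma test_fun_primitive:
  assumes "\<phi> \<in> test_fun {a<..<b}" "a < b" "integral {a..b} \<phi> = 0"
  shows "(\<lambda>x. integral {a..x} \<phi>) \<in> test_fun {a<..<b}"
proof -
  obtain c d where cd: "a < c" "c \<le> d" "d < b" "\<And>x. \<phi> x \<noteq> 0 \<Longrightarrow> x \<in> {c..d}"
    using test_fun_support assms by metis
  have int: "\<phi> integrable_on {x..y}" for x y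
    using test_fun_smooth[OF assms(1)] integrable_continuous_real smooth_continuous_on by blast
  show ?thesis
  proof (rule test_funI[of _ c d])
    show "smooth (\<lambda>x. integral {a..x} \<phi>)"
    proof (rule smooth_primitive[OF test_fun_smooth[OF assms(1)]])
      show "\<phi> x = 0" if "x \<le> a" for x
        using cd(1) cd(4)[of x] that by auto
    qed
    show "x \<in> {c..d}" if nz: "integral {a..x} \<phi> \<noteq> 0" for x
    proof (rule ccontr)
      assume "x \<notin> {c..d}"
      then consider "x < c" | "x > d" by force
      then show False
      proof cases
        case 1
        then have "integral {a..x} \<phi> = integral {a..x} (\<lambda>x. 0)"
          using cd(4) by (intro integral_cong) fastforce
        then show False using nz by simp
      next
        case 2
        \<comment> \<open>The point x may lie on either side of b. Both lie to the right of d, where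
          \<phi> vanishes, so the integrals up to x and up to b both equal the one up to M.\<close>
        define M where "M = max x b"
        have z: "integral {t..M} \<phi> = 0" if "t > d" for t
        proof -
          have "integral {t..M} \<phi> = integral {t..M} (\<lambda>x. 0)"
            using cd(4) that by (intro integral_cong) fastforce
          then show ?thesis by simp
        qed
        have "integral {a..x} \<phi> + integral {x..M} \<phi> = integral {a..M} \<phi>"
          by (rule Henstock_Kurzweil_Integration.integral_combine)
            (use int 2 cd in \<open>auto simp: M_def\<close>)
        moreover have "integral {a..b} \<phi> + integral {b..M} \<phi> = integral {a..M} \<phi>"
          by (rule Henstock_Kurzweil_Integration.integral_combine)
            (use int 2 cd in \<open>auto simp: M_def\<close>)
        ultimately show False
          using nz z[of x] z[of b] 2 cd assms(3) by simp
      qed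
    qed
  qed (use cd in auto)
qed

section \<open>Indicators as limits of test functions, and the fundamental lemma of the calculus of
  variations\<close>

text \<open>A rising and a falling step, steepened by the factor n + 1, are multiplied. The case c
  \<ge> d is allowed: then every \<eta> n is 0, which is convenient when the interval arises as an
  intersection.\<close>

lemma test_fun_approx_indicator:
  obtains \<eta> :: "nat \<Rightarrow> real \<Rightarrow> complex"
  where "\<And>n. \<eta> n \<in> test_fun {c<..<d}" "\<And>n x. cmod (\<eta> n x) \<le> 1"
    "\<And>x. (\<lambda>n. \<eta> n x) \<longlonglongrightarrow> indicator {c<..<d} x"
proof -
  obtain B :: "real \<Rightarrow> complex" where B: "smooth B" "\<And>x. cmod (B x) \<le> 1"
    "\<And>x. x \<le> 0 \<Longrightarrow> B x = 0" "\<And>x. x \<ge> 1 \<Longrightarrow> B x = 1"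
    using smooth_step by blast
  \<comment> \<open>The shift by 1 keeps the support at distance at least 1/(n+1) from c and d; the
    value is 1 as soon as (n+1)(x-c) and (n+1)(d-x) both reach 2.\<close>
  define \<eta> where "\<eta> = (\<lambda>n x. B (real (Suc n) * (x - c) - 1) * B (real (Suc n) * (d - x) - 1))"
  have lim: "eventually (\<lambda>n. B (real (Suc n) * t - 1) = 1) sequentially" if "t > 0" for t
  proof -
    obtain N where N: "2 / t < real N" using reals_Archimedean2 by blast
    have "B (real (Suc n) * t - 1) = 1" if "n \<ge> N" for n
    proof (rule B(4))
      have "2 / t < real (Suc n)" using N that by linarith
      then show "1 \<le> real (Suc n) * t - 1" using \<open>t > 0\<close> by (simp add: field_simps)
    qed
    then show ?thesis by (auto simp: eventually_sequentially)
  qed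
  have supp: "x \<in> {c + 1 / real (Suc n)..d - 1 / real (Suc n)}" if "\<eta> n x \<noteq> 0" for n x
  proof -
    have "real (Suc n) * (x - c) - 1 > 0" "real (Suc n) * (d - x) - 1 > 0"
      using B(3)[of "real (Suc n) * (x - c) - 1"] B(3)[of "real (Suc n) * (d - x) - 1"] that
      unfolding \<eta>_def by (force simp del: of_nat_Suc)+
    then have "1 / real (Suc n) < x - c" "1 / real (Suc n) < d - x"
      by (simp_all add: field_simps del: of_nat_Suc)
    then show ?thesis by auto
  qed
  show thesis
  proof
    show "\<eta> n \<in> test_fun {c<..<d}" for n
    proof (rule test_funI[OF _ supp])
      have "smooth (\<lambda>x. B (real (Suc n) * x + (- real (Suc n) * c - 1))
        * B (- real (Suc n) * x + (real (Suc n) * d - 1)))"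
        by (intro smooth_mult smooth_affine B(1))
      then show "smooth (\<eta> n)"
        by (simp add: \<eta>_def algebra_simps)
      have "1 / real (Suc n) > 0" by simp
      then show "{c + 1 / real (Suc n)..d - 1 / real (Suc n)} \<subseteq> {c<..<d}"
        unfolding subset_iff atLeastAtMost_iff greaterThanLessThan_iff by (intro allI impI) linarith
    qed
    show "cmod (\<eta> n x) \<le> 1" for n x
      using mult_mono[OF B(2) B(2)] by (simp add: \<eta>_def norm_mult)
    show "(\<lambda>n. \<eta> n x) \<longlonglongrightarrow> indicator {c<..<d} x" for x
    proof (cases "x \<in> {c<..<d}")
      case True
      then have "eventually (\<lambda>n. \<eta> n x = 1) sequentially"
        using eventually_conj[OF lim lim, of "x - c" "d - x"]
        by (auto simp: \<eta>_def elim!: eventually_mono)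
      then show ?thesis using True by (simp add: tendsto_eventually)
    next
      case False
      have "\<eta> n x = 0" for n
      proof (rule ccontr)
        assume "\<eta> n x \<noteq> 0"
        moreover have "1 / real (Suc n) > 0" by simp
        ultimately show False
          using supp[of n x] False by (simp only: atLeastAtMost_iff greaterThanLessThan_iff) linarith
      qed
      then show ?thesis using False by simp
    qed
  qed
qed

text \<open>Dynkin's theorem for the intersection-stable generator of open intervals. Only disjoint
  unions occur, so it suits properties that are additive in the set: below, vanishing of an integral
  over A and approximability of the indicator of A.\<close>

lemma borel_interval_induct [consumes 1, case_names empty interval compl union]:
  fixes A :: "real set"
  assumes A: "A \<in> sets borel"
    and empty: "P {}"
    and interval: "\<And>c d. P {c<..<d}"
    and compl: "\<And>A. A \<in> sets borel \<Longrightarrow> P A \<Longrightarrow> P (- A)"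
    and union: "\<And>A::nat \<Rightarrow> real set. disjoint_family A \<Longrightarrow> (\<And>i. A i \<in> sets borel) \<Longrightarrow>
      (\<And>i. P (A i)) \<Longrightarrow> P (\<Union>i. A i)"
  shows "P A"
proof -
  let ?E = "range (\<lambda>(c, d). {c<..<d}) :: real set set"
  have borel: "sets borel = sigma_sets UNIV ?E"
  proof -
    have *: "(\<lambda>(c, d). {c<..<d}) = (\<lambda>(c, d::real). box c d)" by auto
    show ?thesis unfolding * by (subst borel_eq_box) simp
  qed
  have "Int_stable ?E"
  proof (rule Int_stableI)
    fix X Y assume "X \<in> ?E" "Y \<in> ?E"
    then obtain c d c' d' :: real where "X = {c<..<d}" "Y = {c'<..<d'}" by auto
    then have "X \<inter> Y = {max c c'<..<min d d'}" by auto
    then show "X \<inter> Y \<in> ?E" by (auto intro: image_eqI[of _ _ "(max c c', min d d')"])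
  qed
  then show ?thesis
  proof (induction rule: sigma_sets_induct_disjoint[OF _ _ A[unfolded borel],
        consumes 1, case_names sub basic empty compl union])
    case (compl A)
    then show ?case using assms(4)[of A] by (simp add: borel Compl_eq_Diff_UNIV)
  next
    case (union A)
    then show ?case using assms(5)[of A] by (auto simp: borel)
  qed (use empty interval in auto)
qed

lemma smooth_borel: "smooth u \<Longrightarrow> u \<in> borel_measurable borel"
  by (intro borel_measurable_continuous_onI smooth_continuous_on)

lemma borel_imp_lebesgue_on: "u \<in> borel_measurable borel \<Longrightarrow> u \<in> borel_measurable (lebesgue_on S)"
  by (intro measurable_restrict_space1 measurable_completion) simp

lemma test_fun_measurable [measurable]:
  "\<phi> \<in> test_fun J \<Longrightarrow> \<phi> \<in> borel_measurable (lebesgue_on S)"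
  by (intro borel_imp_lebesgue_on smooth_borel test_fun_smooth)

lemma test_fun_bounded:
  assumes "\<phi> \<in> test_fun {a<..<b}" "a < b"
  obtains C where "C > 0" "\<And>x. cmod (\<phi> x) \<le> C"
proof -
  obtain c d where cd: "a < c" "c \<le> d" "d < b" "\<And>x. \<phi> x \<noteq> 0 \<Longrightarrow> x \<in> {c..d}"
    using test_fun_support assms by metis
  have "compact (\<phi> ` {c..d})"
    by (intro compact_continuous_image smooth_continuous_on test_fun_smooth[OF assms(1)]) auto
  then obtain C where "C > 0" "\<And>x. x \<in> {c..d} \<Longrightarrow> cmod (\<phi> x) \<le> C"
    by (metis compact_imp_bounded bounded_pos imageI)
  then show thesis using that cd(4) by (metis norm_zero order_less_imp_le)
qed

text \<open>Orthogonality passes from test functions to indicators of intervals by dominated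
  convergence, from there to Borel sets by induction, and to Lebesgue sets by discarding null sets.
  A function whose integral over every measurable set is 0 vanishes almost everywhere.\<close>

lemma AE_zero_if_orthogonal_test_fun:
  fixes w :: "real \<Rightarrow> complex"
  assumes int: "integrable (lebesgue_on {c<..<d}) w"
    and orth: "\<And>\<phi>. \<phi> \<in> test_fun {c<..<d} \<Longrightarrow> (LINT x|lebesgue_on {c<..<d}. w x * \<phi> x) = 0"
  shows "AE x in lebesgue_on {c<..<d}. w x = 0"
proof -
  let ?J = "{c<..<d}"
  \<comment> \<open>Extension by zero moves the argument to the whole line, where the Borel
    induction takes place.\<close>
  define v where "v = (\<lambda>x. indicat_real ?J x *\<^sub>R w x)"
  have v: "integrable lebesgue v"
    using int by (simp add: v_def integrable_restrict_space)
  have orth': "(LINT x|lebesgue. \<phi> x * v x) = 0" if "\<phi> \<in> test_fun ?J" for \<phi>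
    using orth[OF that] by (simp add: v_def integral_restrict_space mult_ac)
  have interval: "set_lebesgue_integral lebesgue {p<..<q} v = 0" for p q
  proof -
    \<comment> \<open>Clipping to (c, d) turns the approximants into admissible test functions and
      loses nothing, since v is 0 outside.\<close>
    define p' q' where "p' = max c p" "q' = min d q"
    obtain \<eta> :: "nat \<Rightarrow> real \<Rightarrow> complex" where \<eta>: "\<And>n. \<eta> n \<in> test_fun {p'<..<q'}"
      "\<And>n x. cmod (\<eta> n x) \<le> 1" "\<And>x. (\<lambda>n. \<eta> n x) \<longlonglongrightarrow> indicator {p'<..<q'} x"
      using test_fun_approx_indicator by blast
    have \<eta>J: "\<eta> n \<in> test_fun ?J" for n
      by (rule test_fun_subset[OF \<eta>(1)]) (auto simp: p'_q'_def)
    have [measurable]: "\<eta> n \<in> borel_measurable lebesgue" for n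
      using test_fun_measurable[OF \<eta>(1), of _ UNIV] by (simp add: lebesgue_on_UNIV_eq)
    note [measurable] = borel_measurable_integrable[OF v]
    have "(\<lambda>n. LINT x|lebesgue. \<eta> n x * v x) \<longlonglongrightarrow> (LINT x|lebesgue. indicator {p'<..<q'} x * v x)"
    proof (rule integral_dominated_convergence[where w = "\<lambda>x. norm (v x)"])
      show "AE x in lebesgue. (\<lambda>n. \<eta> n x * v x) \<longlonglongrightarrow> indicator {p'<..<q'} x * v x"
        by (intro AE_I2 tendsto_mult \<eta>(3) tendsto_const)
      show "AE x in lebesgue. norm (\<eta> n x * v x) \<le> norm (v x)" for n
        using \<eta>(2) by (intro AE_I2) (simp add: norm_mult mult_left_le_one_le)
      show "(\<lambda>x. indicator {p'<..<q'} x * v x) \<in> borel_measurable lebesgue"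
        by (intro borel_measurable_times borel_measurable_indicator) auto
    qed (use v in auto)
    then have "(LINT x|lebesgue. indicator {p'<..<q'} x * v x) = 0"
      by (simp add: orth'[OF \<eta>J] LIMSEQ_const_iff)
    also have "(\<lambda>x. indicator {p'<..<q'} x * v x) = (\<lambda>x. indicat_real {p<..<q} x *\<^sub>R v x)"
      by (auto simp: fun_eq_iff v_def p'_q'_def indicator_def)
    finally show ?thesis by (simp add: set_lebesgue_integral_def)
  qed
  have si: "set_integrable lebesgue A v" if "A \<in> sets lebesgue" for A
    unfolding set_integrable_def using v that by (rule integrable_mult_indicator[rotated])
  \<comment> \<open>The complement step of the induction needs the integral over the whole line;
    this is the interval case for (c, d).\<close>
  have total: "(LINT x|lebesgue. v x) = 0"
  proof -
    have "(\<lambda>x. indicat_real ?J x *\<^sub>R v x) = v"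
      by (auto simp: v_def fun_eq_iff indicator_def)
    then show ?thesis
      using interval[of c d] by (simp add: set_lebesgue_integral_def)
  qed
  have borel: "set_lebesgue_integral lebesgue A v = 0" if "A \<in> sets borel" for A
    using that
  proof (induction rule: borel_interval_induct)
    case (compl A)
    then have "A \<in> sets lebesgue" by simp
    then have "(LINT x|lebesgue. v x - indicat_real A x *\<^sub>R v x) = 0"
      using v si[of A] compl.IH total
      by (subst Bochner_Integration.integral_diff)
        (auto simp: set_integrable_def set_lebesgue_integral_def)
    also have "(\<lambda>x. v x - indicat_real A x *\<^sub>R v x) = (\<lambda>x. indicat_real (- A) x *\<^sub>R v x)"
      by (auto simp: fun_eq_iff indicator_def)
    finally show ?case by (simp add: set_lebesgue_integral_def)
  next
    case (union A)
    have "set_lebesgue_integral lebesgue (\<Union>i. A i) v = (\<Sum>i. set_lebesgue_integral lebesgue (A i) v)"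
      by (rule lebesgue_integral_countable_add)
        (use union in \<open>auto simp: disjoint_family_on_def intro!: si\<close>)
    then show ?case using union.IH by simp
  qed (use interval in \<open>auto simp: set_lebesgue_integral_def\<close>)
  have lebesgue: "set_lebesgue_integral lebesgue A v = 0" if A: "A \<in> sets lebesgue" for A
  proof -
    obtain S N N' where S: "A = S \<union> N" "N \<subseteq> N'" "N' \<in> null_sets lborel" "S \<in> sets lborel"
      using sets_completionE[OF A] by metis
    have "AE x in lebesgue. x \<notin> N'"
      using S(3) by (intro AE_not_in null_sets_completionI)
    then have "AE x in lebesgue. indicat_real A x *\<^sub>R v x = indicat_real S x *\<^sub>R v x"
      by eventually_elim (use S in \<open>auto simp: indicator_def\<close>)
    then have "set_lebesgue_integral lebesgue A v = set_lebesgue_integral lebesgue S v"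
      unfolding set_lebesgue_integral_def
      by (intro integral_cong_AE)
        (use si[of A] si[of S] that S(4) in \<open>auto simp: set_integrable_def\<close>)
    then show ?thesis using borel S(4) by simp
  qed
  have "finite_measure (lebesgue_on ?J)"
    by (intro finite_measure_lebesgue_on lmeasurable_open) auto
  then have "sigma_finite_measure (lebesgue_on ?J)"
    by (simp add: finite_measure_def)
  then show ?thesis
  proof (rule sigma_finite_measure.density_zero[OF _ int])
    fix A assume "A \<in> sets (lebesgue_on ?J)"
    then have "set_lebesgue_integral lebesgue A v = 0"
      by (intro lebesgue) (simp add: sets_restrict_space_iff)
    moreover have "(\<lambda>x. indicat_real A x *\<^sub>R v x) = (\<lambda>x. indicat_real ?J x *\<^sub>R (indicat_real A x *\<^sub>R w x))"
      by (auto simp: v_def fun_eq_iff)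
    ultimately show "set_lebesgue_integral (lebesgue_on ?J) A w = 0"
      by (simp add: set_lebesgue_integral_def integral_restrict_space)
  qed
qed

section \<open>Density of the test functions in \<open>L\<^sup>2\<close>\<close>

lemma Lp2D:
  assumes "u \<in> Lp 2 J"
  shows "u \<in> borel_measurable (lebesgue_on J)" "integrable (lebesgue_on J) (\<lambda>x. (cmod (u x))\<^sup>2)"
  using assms by (auto simp: Lp_def)

lemma Lp2_bound:
  assumes "u \<in> borel_measurable (lebesgue_on J)" "integrable (lebesgue_on J) g"
    "AE x in lebesgue_on J. (cmod (u x))\<^sup>2 \<le> g x"
  shows "u \<in> Lp 2 J"
  using assms(1) by (auto simp: Lp_def intro!: Bochner_Integration.integrable_bound[OF assms(2)]
      eventually_mono[OF assms(3)])

lemma norm_add_squared_le: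
  fixes x y :: "'a::real_normed_vector"
  shows "(norm (x + y))\<^sup>2 \<le> 2 * (norm x)\<^sup>2 + 2 * (norm y)\<^sup>2"
proof -
  have "(norm (x + y))\<^sup>2 \<le> (norm x + norm y)\<^sup>2"
    by (intro power_mono norm_triangle_ineq) auto
  also have "\<dots> \<le> 2 * (norm x)\<^sup>2 + 2 * (norm y)\<^sup>2"
    using sum_squares_bound[of "norm x" "norm y"] by (simp add: power2_sum)
  finally show ?thesis .
qed

lemma Lp2_add:
  assumes "u \<in> Lp 2 J" "v \<in> Lp 2 J"
  shows "(\<lambda>x. u x + v x) \<in> Lp 2 J"
  by (rule Lp2_bound[where g = "\<lambda>x. 2 * (cmod (u x))\<^sup>2 + 2 * (cmod (v x))\<^sup>2"])
    (use assms[THEN Lp2D(1)] assms[THEN Lp2D(2)] norm_add_squared_le in auto)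

lemma Lp2_cmult:
  assumes "u \<in> Lp 2 J"
  shows "(\<lambda>x. c * u x) \<in> Lp 2 J"
  by (rule Lp2_bound[where g = "\<lambda>x. (cmod c)\<^sup>2 * (cmod (u x))\<^sup>2"])
    (use Lp2D[OF assms] in \<open>auto simp: norm_mult power_mult_distrib\<close>)

lemma Lp2_diff: "u \<in> Lp 2 J \<Longrightarrow> v \<in> Lp 2 J \<Longrightarrow> (\<lambda>x. u x - v x) \<in> Lp 2 J"
  using Lp2_add[of u J "\<lambda>x. - v x"] Lp2_cmult[of v J "-1"] by simp

lemma integral_norm_add_squared_le:
  assumes "u \<in> Lp 2 J" "v \<in> Lp 2 J"
  shows "(LINT x|lebesgue_on J. (cmod (u x + v x))\<^sup>2)
    \<le> 2 * (LINT x|lebesgue_on J. (cmod (u x))\<^sup>2) + 2 * (LINT x|lebesgue_on J. (cmod (v x))\<^sup>2)"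
proof -
  have "(LINT x|lebesgue_on J. (cmod (u x + v x))\<^sup>2)
    \<le> (LINT x|lebesgue_on J. 2 * (cmod (u x))\<^sup>2 + 2 * (cmod (v x))\<^sup>2)"
    using Lp2D[OF assms(1)] Lp2D[OF assms(2)] Lp2D[OF Lp2_add[OF assms]]
    by (intro integral_mono norm_add_squared_le) auto
  then show ?thesis
    using Lp2D[OF assms(1)] Lp2D[OF assms(2)] by simp
qed

lemma Lp2_bounded_mult:
  assumes "u \<in> Lp 2 J" "v \<in> borel_measurable (lebesgue_on J)" "\<And>x. x \<in> J \<Longrightarrow> cmod (v x) \<le> C"
  shows "(\<lambda>x. v x * u x) \<in> Lp 2 J"
proof (rule Lp2_bound[where g = "\<lambda>x. C\<^sup>2 * (cmod (u x))\<^sup>2"])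
  show "AE x in lebesgue_on J. (cmod (v x * u x))\<^sup>2 \<le> C\<^sup>2 * (cmod (u x))\<^sup>2"
    using assms(3) by (auto simp: norm_mult power_mult_distrib intro!: AE_I2 mult_right_mono power_mono)
qed (use Lp2D[OF assms(1)] assms(2) in auto)

lemma Lp2_mult_integrable:
  assumes "u \<in> Lp 2 J" "v \<in> Lp 2 J"
  shows "integrable (lebesgue_on J) (\<lambda>x. u x * v x)"
proof (rule Bochner_Integration.integrable_bound)
  show "integrable (lebesgue_on J) (\<lambda>x. (cmod (u x))\<^sup>2 + (cmod (v x))\<^sup>2)"
    using assms[THEN Lp2D(2)] by auto
  have "cmod (u x * v x) \<le> (cmod (u x))\<^sup>2 + (cmod (v x))\<^sup>2" for x
    using sum_squares_bound[of "cmod (u x)" "cmod (v x)"]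
      mult_nonneg_nonneg[OF norm_ge_zero norm_ge_zero, of "u x" "v x"]
    unfolding norm_mult by linarith
  then show "AE x in lebesgue_on J. norm (u x * v x) \<le> norm ((cmod (u x))\<^sup>2 + (cmod (v x))\<^sup>2)"
    by (intro AE_I2) auto
qed (use assms[THEN Lp2D(1)] in auto)

lemma integrable_const_lebesgue_on_Ioo: "integrable (lebesgue_on {a<..<b::real}) (\<lambda>x. c :: 'a::euclidean_space)"
proof -
  have "finite_measure (lebesgue_on {a<..<b})"
    by (intro finite_measure_lebesgue_on lmeasurable_open) auto
  then show ?thesis by (simp add: finite_measure.integrable_const)
qed

lemma Lp2_bounded:
  assumes "u \<in> borel_measurable (lebesgue_on {a<..<b})" "\<And>x. x \<in> {a<..<b} \<Longrightarrow> cmod (u x) \<le> C"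
  shows "u \<in> Lp 2 {a<..<b}"
proof (rule Lp2_bound[where g = "\<lambda>x. C\<^sup>2"])
  show "AE x in lebesgue_on {a<..<b}. (cmod (u x))\<^sup>2 \<le> C\<^sup>2"
    using assms(2) by (intro AE_I2 power_mono) auto
qed (use assms integrable_const_lebesgue_on_Ioo in auto)

lemma Lp2_imp_integrable:
  assumes "u \<in> Lp 2 {a<..<b}"
  shows "integrable (lebesgue_on {a<..<b}) u"
  using Lp2_mult_integrable[OF assms Lp2_bounded[of "\<lambda>x. 1" _ _ 1]] by simp

lemma test_fun_Lp2: "\<phi> \<in> test_fun {a<..<b} \<Longrightarrow> a < b \<Longrightarrow> \<phi> \<in> Lp 2 {a<..<b}"
  by (metis Lp2_bounded test_fun_bounded test_fun_measurable)

lemma Lp2_tendsto_dominated: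
  fixes s :: "nat \<Rightarrow> real \<Rightarrow> complex"
  assumes "\<And>n. s n \<in> borel_measurable (lebesgue_on J)" "u \<in> borel_measurable (lebesgue_on J)"
    and lim: "\<And>x. x \<in> J \<Longrightarrow> (\<lambda>n. s n x) \<longlonglongrightarrow> u x"
    and g: "integrable (lebesgue_on J) g" "\<And>n x. x \<in> J \<Longrightarrow> (cmod (u x - s n x))\<^sup>2 \<le> g x"
  shows "(\<lambda>n. LINT x|lebesgue_on J. (cmod (u x - s n x))\<^sup>2) \<longlonglongrightarrow> 0"
proof -
  have "(\<lambda>n. LINT x|lebesgue_on J. (cmod (u x - s n x))\<^sup>2) \<longlonglongrightarrow> (LINT x|lebesgue_on J. 0)"
  proof (rule integral_dominated_convergence[where w = g])
    show "AE x in lebesgue_on J. (\<lambda>n. (cmod (u x - s n x))\<^sup>2) \<longlonglongrightarrow> 0"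
    proof (rule AE_I2)
      fix x assume "x \<in> space (lebesgue_on J)"
      then have "(\<lambda>n. (cmod (u x - s n x))\<^sup>2) \<longlonglongrightarrow> (cmod (u x - u x))\<^sup>2"
        by (intro tendsto_intros lim) simp
      then show "(\<lambda>n. (cmod (u x - s n x))\<^sup>2) \<longlonglongrightarrow> 0" by simp
    qed
  qed (use assms in auto)
  then show ?thesis by simp
qed

section \<open>The mean-square closure of the test functions\<close>

text \<open>The distance is left squared, so that the elementary bound for the square of a sum, with
  its factor 2, takes the place of the triangle inequality in the norm.\<close>

definition test_fun_approximable :: "real set \<Rightarrow> (real \<Rightarrow> complex) \<Rightarrow> bool" where
  "test_fun_approximable J u \<longleftrightarrow> u \<in> Lp 2 J \<and>
    (\<forall>e>0. \<exists>\<phi>\<in>test_fun J. (LINT x|lebesgue_on J. (cmod (u x - \<phi> x))\<^sup>2) < e)"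

lemma test_fun_approximable_limit:
  assumes "a < b" "u \<in> Lp 2 {a<..<b}" "\<And>n::nat. test_fun_approximable {a<..<b} (s n)"
    and lim: "(\<lambda>n. LINT x|lebesgue_on {a<..<b}. (cmod (u x - s n x))\<^sup>2) \<longlonglongrightarrow> 0"
  shows "test_fun_approximable {a<..<b} u"
  unfolding test_fun_approximable_def
proof (intro conjI allI impI)
  fix e :: real assume "e > 0"
  let ?I = "\<lambda>v. LINT x|lebesgue_on {a<..<b}. (cmod (v x))\<^sup>2"
  \<comment> \<open>The quarter absorbs the factor 2 of \<open>integral_norm_add_squared_le\<close>:
    2 e/4 + 2 e/4 = e.\<close>
  obtain n where n: "?I (\<lambda>x. u x - s n x) < e / 4"
    using order_tendstoD(2)[OF lim, of "e / 4"] \<open>e > 0\<close> by (auto simp: eventually_sequentially)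
  obtain \<phi> where \<phi>: "\<phi> \<in> test_fun {a<..<b}" "?I (\<lambda>x. s n x - \<phi> x) < e / 4"
    using assms(3)[of n] \<open>e > 0\<close> unfolding test_fun_approximable_def
    by (meson divide_pos_pos zero_less_numeral)
  have s: "s n \<in> Lp 2 {a<..<b}"
    using assms(3) by (simp add: test_fun_approximable_def)
  have "?I (\<lambda>x. u x - \<phi> x) \<le> 2 * ?I (\<lambda>x. u x - s n x) + 2 * ?I (\<lambda>x. s n x - \<phi> x)"
    using integral_norm_add_squared_le[OF Lp2_diff[OF assms(2) s]
        Lp2_diff[OF s test_fun_Lp2[OF \<phi>(1) \<open>a < b\<close>]]] by simp
  then have "?I (\<lambda>x. u x - \<phi> x) < e" using n \<phi>(2) by linarith
  then show "\<exists>\<phi>\<in>test_fun {a<..<b}. ?I (\<lambda>x. u x - \<phi> x) < e" using \<phi>(1) by blast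
qed fact

lemma test_fun_approximable_add:
  assumes "a < b" "test_fun_approximable {a<..<b} u" "test_fun_approximable {a<..<b} v"
  shows "test_fun_approximable {a<..<b} (\<lambda>x. u x + v x)"
  unfolding test_fun_approximable_def
proof (intro conjI allI impI)
  have uv: "u \<in> Lp 2 {a<..<b}" "v \<in> Lp 2 {a<..<b}"
    using assms by (auto simp: test_fun_approximable_def)
  then show "(\<lambda>x. u x + v x) \<in> Lp 2 {a<..<b}" by (rule Lp2_add)
  fix e :: real assume "e > 0"
  let ?I = "\<lambda>v. LINT x|lebesgue_on {a<..<b}. (cmod (v x))\<^sup>2"
  have "e / 4 > 0" using \<open>e > 0\<close> by simp
  then obtain \<phi> \<psi> where \<phi>: "\<phi> \<in> test_fun {a<..<b}" "?I (\<lambda>x. u x - \<phi> x) < e / 4"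
    and \<psi>: "\<psi> \<in> test_fun {a<..<b}" "?I (\<lambda>x. v x - \<psi> x) < e / 4"
    using assms(2,3) unfolding test_fun_approximable_def by meson
  have "?I (\<lambda>x. (u x - \<phi> x) + (v x - \<psi> x)) \<le> 2 * ?I (\<lambda>x. u x - \<phi> x) + 2 * ?I (\<lambda>x. v x - \<psi> x)"
    by (intro integral_norm_add_squared_le Lp2_diff uv test_fun_Lp2 \<phi> \<psi> \<open>a < b\<close>)
  then have "?I (\<lambda>x. (u x + v x) - (\<phi> x + \<psi> x)) < e"
    using \<phi>(2) \<psi>(2) by (simp add: add_diff_add)
  then show "\<exists>\<phi>\<in>test_fun {a<..<b}. ?I (\<lambda>x. (u x + v x) - \<phi> x) < e"
    using test_fun_add[OF \<phi>(1) \<psi>(1) \<open>a < b\<close>] by (rule bexI)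
qed

lemma test_fun_approximable_cmult:
  assumes "a < b" "test_fun_approximable {a<..<b} u"
  shows "test_fun_approximable {a<..<b} (\<lambda>x. c * u x)"
  unfolding test_fun_approximable_def
proof (intro conjI allI impI)
  have u: "u \<in> Lp 2 {a<..<b}"
    using assms by (auto simp: test_fun_approximable_def)
  then show "(\<lambda>x. c * u x) \<in> Lp 2 {a<..<b}" by (rule Lp2_cmult)
  fix e :: real assume "e > 0"
  let ?I = "\<lambda>v. LINT x|lebesgue_on {a<..<b}. (cmod (v x))\<^sup>2"
  \<comment> \<open>The summand 1 keeps the divisor positive when c = 0.\<close>
  define k where "k = (cmod c)\<^sup>2 + 1"
  have k: "k > 0" "(cmod c)\<^sup>2 \<le> k" by (auto simp: k_def add_nonneg_pos)
  have "e / k > 0" using \<open>e > 0\<close> k by simp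
  then obtain \<phi> where \<phi>: "\<phi> \<in> test_fun {a<..<b}" "?I (\<lambda>x. u x - \<phi> x) < e / k"
    using assms(2) unfolding test_fun_approximable_def by meson
  have "?I (\<lambda>x. c * u x - c * \<phi> x) = (cmod c)\<^sup>2 * ?I (\<lambda>x. u x - \<phi> x)"
    by (simp add: right_diff_distrib[symmetric] norm_mult power_mult_distrib)
  also have "\<dots> \<le> k * ?I (\<lambda>x. u x - \<phi> x)"
    using k by (intro mult_right_mono) auto
  also have "\<dots> < e" using \<phi>(2) k by (simp add: field_simps)
  finally show "\<exists>\<phi>\<in>test_fun {a<..<b}. ?I (\<lambda>x. c * u x - \<phi> x) < e"
    using test_fun_mult[OF \<phi>(1) smooth_const[of c] \<open>a < b\<close>] by (rule bexI)
qed

lemma test_fun_approximable_zero: "a < b \<Longrightarrow> test_fun_approximable {a<..<b} (\<lambda>x. 0)"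
  using test_funI[OF smooth_const[of 0], of "(a+b)/2" "(a+b)/2" "{a<..<b}"]
    Lp2_bounded[of "\<lambda>x. 0" a b 0]
  by (auto simp: test_fun_approximable_def intro!: bexI[of _ "\<lambda>x. 0"])

lemma test_fun_approximable_sum:
  assumes "a < b" "\<And>i. i \<in> I \<Longrightarrow> test_fun_approximable {a<..<b} (s i)"
  shows "test_fun_approximable {a<..<b} (\<lambda>x. \<Sum>i\<in>I. s i x)"
  using assms(2)
  by (induction I rule: infinite_finite_induct)
    (auto intro: test_fun_approximable_zero test_fun_approximable_add assms(1))

lemma test_fun_approximable_cong:
  assumes "test_fun_approximable J u" "v \<in> borel_measurable (lebesgue_on J)"
    and ae: "AE x in lebesgue_on J. u x = v x"
  shows "test_fun_approximable J v"
proof -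
  have u: "u \<in> borel_measurable (lebesgue_on J)"
    using assms(1) by (auto simp: test_fun_approximable_def Lp_def)
  have "integrable (lebesgue_on J) (\<lambda>x. (cmod (v x))\<^sup>2) \<longleftrightarrow> integrable (lebesgue_on J) (\<lambda>x. (cmod (u x))\<^sup>2)"
    by (rule integrable_cong_AE) (use assms(2) u ae in auto)
  moreover have "(LINT x|lebesgue_on J. (cmod (v x - \<phi> x))\<^sup>2) = (LINT x|lebesgue_on J. (cmod (u x - \<phi> x))\<^sup>2)"
    if "\<phi> \<in> test_fun J" for \<phi>
    by (rule integral_cong_AE) (use assms(2) u ae test_fun_measurable[OF that] in auto)
  ultimately show ?thesis
    using assms(1,2) by (auto simp: test_fun_approximable_def Lp_def)
qed

lemma test_fun_approximable_indicator_interval: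
  assumes "a < b"
  shows "test_fun_approximable {a<..<b} (indicator {p<..<q})"
proof -
  define p' q' where "p' = max a p" "q' = min b q"
  obtain \<eta> :: "nat \<Rightarrow> real \<Rightarrow> complex" where \<eta>: "\<And>n. \<eta> n \<in> test_fun {p'<..<q'}"
    "\<And>n x. cmod (\<eta> n x) \<le> 1" "\<And>x. (\<lambda>n. \<eta> n x) \<longlonglongrightarrow> indicator {p'<..<q'} x"
    using test_fun_approx_indicator by blast
  have \<eta>J: "\<eta> n \<in> test_fun {a<..<b}" for n
    by (rule test_fun_subset[OF \<eta>(1)]) (auto simp: p'_q'_def)
  have eq: "indicator {p'<..<q'} x = (indicator {p<..<q} x :: complex)" if "x \<in> {a<..<b}" for x
    using that by (auto simp: p'_q'_def indicator_def)
  show ?thesis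
  proof (rule test_fun_approximable_limit[OF assms, where s = \<eta>])
    show "indicator {p<..<q} \<in> Lp 2 {a<..<b}"
      by (rule Lp2_bounded[where C = 1]) (auto intro!: borel_imp_lebesgue_on simp: indicator_def)
    show "test_fun_approximable {a<..<b} (\<eta> n)" for n
      using \<eta>J[of n] test_fun_Lp2[OF \<eta>J[of n] assms]
      by (auto simp: test_fun_approximable_def intro!: bexI[of _ "\<eta> n"])
    show "(\<lambda>n. LINT x|lebesgue_on {a<..<b}. (cmod (indicator {p<..<q} x - \<eta> n x))\<^sup>2) \<longlonglongrightarrow> 0"
    proof (rule Lp2_tendsto_dominated[where g = "\<lambda>x. 4"])
      \<comment> \<open>Both terms have modulus at most 1, so the square of the sum is at most 2 +
        2.\<close>
      show "(cmod (indicator {p<..<q} x - \<eta> n x))\<^sup>2 \<le> 4" for n x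
        using norm_add_squared_le[of "indicator {p<..<q} x" "- \<eta> n x"] \<eta>(2)[of n x]
          power_le_one[OF norm_ge_zero \<eta>(2), of n x 2]
        by (auto simp: indicator_def split: if_splits)
    qed (use eq \<eta>(3) test_fun_measurable[OF \<eta>(1)] in
        \<open>auto intro!: borel_imp_lebesgue_on integrable_const_lebesgue_on_Ioo\<close>, metis)
  qed
qed

text \<open>The approximable functions are closed under linear combinations and mean-square limits,
  which is what complements and countable disjoint unions require.\<close>

lemma test_fun_approximable_indicator_borel:
  assumes "a < b" "A \<in> sets borel"
  shows "test_fun_approximable {a<..<b} (indicator A)"
  using assms(2)
proof (induction rule: borel_interval_induct)
  case empty
  then show ?case using test_fun_approximable_zero[OF \<open>a < b\<close>] by simp
next
  case (interval p q)
  show ?case using \<open>a < b\<close> by (rule test_fun_approximable_indicator_interval)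
next
  case (compl A)
  \<comment> \<open>On (a, b) the constant 1 is the indicator of (a, b); the complement of A then
    has the indicator 1 + (-1) times that of A.\<close>
  have "test_fun_approximable {a<..<b} (\<lambda>x. 1)"
    using test_fun_approximable_indicator_interval[OF \<open>a < b\<close>, of a b]
    by (rule test_fun_approximable_cong) (auto intro: AE_I2)
  from test_fun_approximable_add[OF \<open>a < b\<close> this
      test_fun_approximable_cmult[OF \<open>a < b\<close> compl.IH, of "-1"]]
  show ?case
    by (rule back_subst[where P = "test_fun_approximable _"]) (auto simp: indicator_def)
next
  case (union A)
  show ?case
  proof (rule test_fun_approximable_limit[OF \<open>a < b\<close>, where s = "\<lambda>n x. \<Sum>i<n. indicator (A i) x"])
    have sets: "(\<Union>i. A i) \<in> sets borel" using union by auto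
    show "indicator (\<Union>i. A i) \<in> Lp 2 {a<..<b}"
      by (rule Lp2_bounded[where C = 1]) (use sets in \<open>auto intro!: borel_imp_lebesgue_on simp: indicator_def\<close>)
    show "test_fun_approximable {a<..<b} (\<lambda>x. \<Sum>i<n. indicator (A i) x)" for n
      by (intro test_fun_approximable_sum \<open>a < b\<close> union.IH)
    \<comment> \<open>Disjointness turns the partial sums into indicators of finite unions, which
      bounds them uniformly and lets a constant dominate.\<close>
    have fin: "(\<Sum>i<n. indicator (A i) x) = (indicator (\<Union>i<n. A i) x :: complex)" for n x
      by (rule indicator_UN_disjoint[symmetric])
        (use union in \<open>auto simp: disjoint_family_on_def\<close>)
    have lim: "(\<lambda>n. \<Sum>i<n. indicator (A i) x :: complex) \<longlonglongrightarrow> indicator (\<Union>i. A i) x" for x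
      unfolding fin by (rule LIMSEQ_indicator_UN)
    show "(\<lambda>n. LINT x|lebesgue_on {a<..<b}. (cmod (indicator (\<Union>i. A i) x - (\<Sum>i<n. indicator (A i) x)))\<^sup>2) \<longlonglongrightarrow> 0"
    proof (rule Lp2_tendsto_dominated[where g = "\<lambda>x. 4"])
      show "(cmod (indicator (\<Union>i. A i) x - (\<Sum>i<n. indicator (A i) x)))\<^sup>2 \<le> 4" for n x
        unfolding fin by (auto simp: indicator_def)
    qed (use lim sets union in
        \<open>auto intro!: borel_imp_lebesgue_on integrable_const_lebesgue_on_Ioo\<close>)
  qed
qed

text \<open>Measurable sets differ from Borel sets by null sets, simple functions are finite
  combinations of indicators, and u is a pointwise limit of simple functions dominated by 2
  |u|.\<close>

lemma Lp2_test_fun_approximable: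
  assumes "a < b" "u \<in> Lp 2 {a<..<b}"
  shows "test_fun_approximable {a<..<b} u"
proof -
  let ?M = "lebesgue_on {a<..<b}"
  have indicator: "test_fun_approximable {a<..<b} (indicator A)" if A: "A \<in> sets ?M" for A
  proof -
    have "A \<in> sets lebesgue" using A by (simp add: sets_restrict_space_iff)
    then obtain S N N' where S: "A = S \<union> N" "N \<subseteq> N'" "N' \<in> null_sets lborel" "S \<in> sets lborel"
      by (metis sets_completionE)
    have "AE x in lebesgue. x \<notin> N'"
      using S(3) by (intro AE_not_in null_sets_completionI)
    then have "AE x in ?M. x \<notin> N'"
      by (simp add: AE_restrict_space_iff) (auto elim: eventually_mono)
    then have "AE x in ?M. indicator S x = (indicator A x :: complex)"
      by eventually_elim (use S in \<open>auto simp: indicator_def\<close>)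
    moreover have "test_fun_approximable {a<..<b} (indicator S)"
      using test_fun_approximable_indicator_borel[OF assms(1), of S] S(4) by simp
    moreover have "indicator A \<in> borel_measurable ?M"
      using A by (rule borel_measurable_indicator)
    ultimately show ?thesis
      by (metis test_fun_approximable_cong)
  qed
  have simple: "test_fun_approximable {a<..<b} s" if s: "simple_function ?M s" for s
  proof (rule test_fun_approximable_cong)
    show "test_fun_approximable {a<..<b}
        (\<lambda>x. \<Sum>y\<in>s ` {a<..<b}. y * indicator (s -` {y} \<inter> {a<..<b}) x)"
      using simple_functionD(2)[OF s]
      by (intro test_fun_approximable_sum test_fun_approximable_cmult indicator assms(1)) auto
    have "(\<Sum>y\<in>s ` {a<..<b}. y * indicator (s -` {y} \<inter> {a<..<b}) x) = s x" if "x \<in> {a<..<b}" for x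
    proof -
      have "(\<Sum>y\<in>s ` {a<..<b}. y * indicator (s -` {y} \<inter> {a<..<b}) x)
        = (\<Sum>y\<in>s ` {a<..<b}. if y = s x then y else 0)"
        using that by (intro sum.cong) (auto simp: indicator_def)
      also have "\<dots> = s x"
        using simple_functionD(1)[OF s] that by (subst sum.delta) auto
      finally show ?thesis .
    qed
    then show "AE x in ?M. (\<Sum>y\<in>s ` {a<..<b}. y * indicator (s -` {y} \<inter> {a<..<b}) x) = s x"
      by (intro AE_I2) auto
  qed (use s borel_measurable_simple_function in auto)
  obtain s where "\<forall>i. simple_function ?M (s i)"
    "\<forall>x\<in>space ?M. (\<lambda>i. s i x) \<longlonglongrightarrow> u x"
    "\<forall>i. \<forall>x\<in>space ?M. dist (s i x) 0 \<le> 2 * dist (u x) 0"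
    using borel_measurable_implies_sequence_metric[OF Lp2D(1)[OF assms(2)], of 0] by metis
  then have s: "simple_function ?M (s i)"
    "x \<in> {a<..<b} \<Longrightarrow> (\<lambda>i. s i x) \<longlonglongrightarrow> u x"
    "x \<in> {a<..<b} \<Longrightarrow> cmod (s i x) \<le> 2 * cmod (u x)" for i x
    by (simp_all add: dist_norm)
  show ?thesis
  proof (rule test_fun_approximable_limit[OF assms simple[OF s(1)]])
    show "(\<lambda>n. LINT x|?M. (cmod (u x - s n x))\<^sup>2) \<longlonglongrightarrow> 0"
    proof (rule Lp2_tendsto_dominated[where g = "\<lambda>x. 9 * (cmod (u x))\<^sup>2"])
      show "(cmod (u x - s n x))\<^sup>2 \<le> 9 * (cmod (u x))\<^sup>2" if "x \<in> {a<..<b}" for n x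
      proof -
        \<comment> \<open>Here 3 = 1 + 2, with 2 from the growth bound on the simple functions; the
          dominating function carries its square, 9.\<close>
        have "cmod (u x - s n x) \<le> 3 * cmod (u x)"
          using norm_triangle_ineq4[of "u x" "s n x"] s(3)[OF that, of n] by linarith
        from power_mono[OF this norm_ge_zero, of 2] show ?thesis
          by (simp add: power_mult_distrib)
      qed
    qed (use s(2) borel_measurable_simple_function[OF s(1)] Lp2D[OF assms(2)] in auto)
  qed
qed

section \<open>Primitives of integrable functions\<close>

text \<open>Absolute continuity in integral form. No pointwise derivative of u is asserted, and w
  matters only up to a null set.\<close>

definition abs_cont_deriv :: "real \<Rightarrow> real \<Rightarrow> (real \<Rightarrow> complex) \<Rightarrow> (real \<Rightarrow> complex) \<Rightarrow> bool" where
  "abs_cont_deriv a b u w \<longleftrightarrow> w absolutely_integrable_on {a..b} \<and>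
    (\<forall>x\<in>{a..b}. u x = u a + integral {a..x} w)"

lemma integral_diff_Icc:
  fixes w :: "real \<Rightarrow> 'a::banach"
  assumes "w integrable_on {a..b}" "a \<le> c" "c \<le> d" "d \<le> b"
  shows "integral {a..d} w - integral {a..c} w = integral {c..d} w"
proof -
  have "w integrable_on {a..d}"
    using assms by (auto intro: integrable_subinterval_real)
  from Henstock_Kurzweil_Integration.integral_combine[OF assms(2,3) this]
  show ?thesis by (simp add: algebra_simps)
qed

context
  fixes a b :: real and u w :: "real \<Rightarrow> complex"
  assumes u: "abs_cont_deriv a b u w"
begin

lemma abs_cont_deriv_integrable: "w absolutely_integrable_on {a..b}"
  using u unfolding abs_cont_deriv_def by blast

lemma abs_cont_deriv_eq: "x \<in> {a..b} \<Longrightarrow> u x = u a + integral {a..x} w"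
  using u unfolding abs_cont_deriv_def by blast

lemma abs_cont_deriv_integrable_sub:
  assumes "a \<le> c" "d \<le> b"
  shows "w absolutely_integrable_on {c..d}" "w integrable_on {c..d}"
    "(\<lambda>x. cmod (w x)) integrable_on {c..d}"
proof -
  show "w absolutely_integrable_on {c..d}"
    by (rule absolutely_integrable_on_subinterval[OF abs_cont_deriv_integrable]) (use assms in auto)
  then show "w integrable_on {c..d}" "(\<lambda>x. cmod (w x)) integrable_on {c..d}"
    by (auto simp: absolutely_integrable_on_def)
qed

lemma abs_cont_deriv_diff:
  assumes "a \<le> c" "c \<le> d" "d \<le> b"
  shows "u d - u c = integral {c..d} w"
proof -
  have "u d = u a + integral {a..d} w" "u c = u a + integral {a..c} w"
    using abs_cont_deriv_eq[of d] abs_cont_deriv_eq[of c] assms by auto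
  then show ?thesis
    using integral_diff_Icc[OF abs_cont_deriv_integrable_sub(2) assms] by simp
qed

lemma abs_cont_deriv_continuous: "continuous_on {a..b} u"
proof -
  have "continuous_on {a..b} (\<lambda>x. u a + integral {a..x} w)"
    using abs_cont_deriv_integrable_sub(2)[of a b]
    by (intro continuous_on_add continuous_on_const indefinite_integral_continuous_1) auto
  then show ?thesis
    by (rule continuous_on_eq) (simp add: abs_cont_deriv_eq[symmetric])
qed

lemma abs_cont_deriv_norm_diff:
  assumes "a \<le> c" "c \<le> d" "d \<le> b"
  shows "cmod (u d - u c) \<le> integral {c..d} (\<lambda>x. cmod (w x))"
  unfolding abs_cont_deriv_diff[OF assms]
  using abs_cont_deriv_integrable_sub[OF assms(1,3)]
  by (intro integral_norm_bound_integral) auto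

end

text \<open>
  This replaces the almost everywhere differentiability of absolutely continuous functions: the
  product and reciprocal rules follow because both sides differ on \<open>[c, d]\<close> by at most a multiple of
  \<open>(\<integral>\<^sub>c\<^sup>d g)\<^sup>2\<close> for some integrable \<open>g\<close>.
\<close>

lemma constant_if_quadratic_increments:
  fixes e :: "real \<Rightarrow> 'a::real_normed_vector" and k :: "real \<Rightarrow> real"
  assumes "a \<le> b" and k: "continuous_on {a..b} k"
    and mono: "\<And>c d. a \<le> c \<Longrightarrow> c \<le> d \<Longrightarrow> d \<le> b \<Longrightarrow> k c \<le> k d"
    and inc: "\<And>c d. a \<le> c \<Longrightarrow> c \<le> d \<Longrightarrow> d \<le> b \<Longrightarrow> norm (e d - e c) \<le> C * (k d - k c)\<^sup>2"
  shows "e b = e a"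
proof -
  define V where "V = \<bar>C\<bar> * (k b - k a)"
  have V: "V \<ge> 0" using mono[of a b] assms(1) by (simp add: V_def)
  \<comment> \<open>On a partition finer than the modulus of uniform continuity of k each increment
    \<Delta> of k satisfies 0 \<le> \<Delta> \<le> \<epsilon>, hence C \<Delta>^2 \<le> \<epsilon>
    |C| \<Delta>, and these bounds telescope to \<epsilon> V.\<close>
  have bound: "norm (e b - e a) \<le> \<epsilon> * V" if "\<epsilon> > 0" for \<epsilon>
  proof -
    have "\<exists>\<delta>>0. \<forall>x\<in>{a..b}. \<forall>y\<in>{a..b}. dist y x < \<delta> \<longrightarrow> dist (k y) (k x) < \<epsilon>"
      using compact_uniformly_continuous[OF k compact_Icc] that
      unfolding uniformly_continuous_on_def by blast
    then obtain \<delta> where \<delta>: "\<delta> > 0"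
      "\<And>x y. x \<in> {a..b} \<Longrightarrow> y \<in> {a..b} \<Longrightarrow> dist y x < \<delta> \<Longrightarrow> dist (k y) (k x) < \<epsilon>"
      by blast
    obtain N where N: "(b - a) / \<delta> < real N" using reals_Archimedean2 by blast
    moreover have "0 \<le> (b - a) / \<delta>" using assms(1) \<delta>(1) by simp
    ultimately have N0: "real N > 0" by linarith
    define h where "h = (b - a) / real N"
    have h: "0 \<le> h" "h < \<delta>" "real N * h = b - a"
      using N N0 \<delta>(1) assms(1) by (auto simp: h_def field_simps)
    define t where "t = (\<lambda>i. a + real i * h)"
    have t: "a \<le> t i" "t i \<le> t (Suc i)" "t (Suc i) \<le> b" "t (Suc i) - t i < \<delta>" if "i < N" for i
    proof -
      have "real (Suc i) * h \<le> real N * h"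
        using that h(1) by (intro mult_right_mono) auto
      then show "t (Suc i) \<le> b" using h by (simp add: t_def del: of_nat_Suc)
    qed (use h in \<open>auto simp: t_def algebra_simps\<close>)
    have "norm (e (t (Suc i)) - e (t i)) \<le> \<epsilon> * \<bar>C\<bar> * (k (t (Suc i)) - k (t i))" if "i < N" for i
    proof -
      define \<Delta> where "\<Delta> = k (t (Suc i)) - k (t i)"
      have \<Delta>: "0 \<le> \<Delta>" "\<Delta> \<le> \<epsilon>"
        using mono[OF t(1-3)[OF that]] t[OF that] \<delta>(2)[of "t i" "t (Suc i)"]
        by (auto simp: \<Delta>_def dist_real_def)
      have "norm (e (t (Suc i)) - e (t i)) \<le> C * \<Delta>\<^sup>2"
        unfolding \<Delta>_def by (rule inc[OF t(1-3)[OF that]])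
      also have "\<dots> \<le> \<bar>C\<bar> * (\<epsilon> * \<Delta>)"
        using \<Delta> by (intro mult_mono) (auto simp: power2_eq_square mult_right_mono)
      finally show ?thesis by (simp add: \<Delta>_def mult_ac)
    qed
    then have *: "norm (\<Sum>i<N. e (t (Suc i)) - e (t i)) \<le> (\<Sum>i<N. \<epsilon> * \<bar>C\<bar> * (k (t (Suc i)) - k (t i)))"
      by (intro sum_norm_le) auto
    have "t N = b" "t 0 = a" using h by (auto simp: t_def)
    moreover have "(\<Sum>i<N. e (t (Suc i)) - e (t i)) = e (t N) - e (t 0)"
      by (rule sum_lessThan_telescope)
    moreover have "(\<Sum>i<N. \<epsilon> * \<bar>C\<bar> * (k (t (Suc i)) - k (t i))) = \<epsilon> * \<bar>C\<bar> * (k (t N) - k (t 0))"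
      unfolding sum_distrib_left[symmetric] sum_lessThan_telescope[of "\<lambda>i. k (t i)" N] ..
    ultimately show ?thesis
      using * by (simp add: V_def mult.assoc)
  qed
  have "norm (e b - e a) \<le> \<eta>" if "\<eta> > 0" for \<eta> :: real
  proof -
    \<comment> \<open>The divisor is V + 1 because V may be 0.\<close>
    have "norm (e b - e a) \<le> \<eta> / (V + 1) * V"
      using that V by (intro bound) auto
    also have "\<dots> \<le> \<eta>"
      using that V by (simp add: field_simps)
    finally show ?thesis .
  qed
  then have "norm (e b - e a) \<le> 0"
    by (meson dense_ge)
  then show ?thesis by simp
qed

lemma absolutely_integrable_mult_continuous:
  fixes w v :: "real \<Rightarrow> complex"
  assumes "w absolutely_integrable_on {a..b}" "continuous_on {a..b} v"
  shows "(\<lambda>x. w x * v x) absolutely_integrable_on {a..b}"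
proof -
  have "(\<lambda>x. v x * w x) absolutely_integrable_on {a..b}"
  proof (rule absolutely_integrable_bounded_measurable_product[where h = "(*)", OF _ _ _ _ assms(1)])
    show "bilinear ((*) :: complex \<Rightarrow> _)"
      using bilinear_conv_bounded_bilinear bounded_bilinear_mult by blast
    show "v \<in> borel_measurable (lebesgue_on {a..b})"
      using assms(2) by (intro continuous_imp_measurable_on_sets_lebesgue) auto
    show "bounded (v ` {a..b})"
      using assms(2) by (intro compact_imp_bounded compact_continuous_image) auto
  qed auto
  then show ?thesis by (simp add: mult.commute)
qed

text \<open>Subtracting the primitive of w from u leaves a function whose increments are quadratic
  in those of the primitive of g, hence a constant.\<close>

lemma abs_cont_deriv_if_quadratic_increments:
  assumes w: "w absolutely_integrable_on {a..b}"
    and g: "g absolutely_integrable_on {a..b}"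
    and inc: "\<And>c d. a \<le> c \<Longrightarrow> c \<le> d \<Longrightarrow> d \<le> b \<Longrightarrow>
      cmod (u d - u c - integral {c..d} w) \<le> C * (integral {c..d} g)\<^sup>2"
    and pos: "\<And>x. 0 \<le> g x"
  shows "abs_cont_deriv a b u w"
  unfolding abs_cont_deriv_def
proof (intro conjI ballI w)
  fix x assume x: "x \<in> {a..b}"
  have wi: "w integrable_on {a..b}" and gi: "g integrable_on {a..b}"
    using w g by (auto simp: absolutely_integrable_on_def)
  define e where "e = (\<lambda>t. u t - integral {a..t} w)"
  have "e x = e a"
  proof (rule constant_if_quadratic_increments[where k = "\<lambda>t. integral {a..t} g" and C = C])
    have "g integrable_on {a..x}" using gi x by (auto intro: integrable_subinterval_real)
    then show "continuous_on {a..x} (\<lambda>t. integral {a..t} g)"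
      by (rule indefinite_integral_continuous_1)
    show "integral {a..c} g \<le> integral {a..d} g" if "a \<le> c" "c \<le> d" "d \<le> x" for c d
    proof -
      have "integral {c..d} g \<ge> 0"
        using that x gi pos
        by (intro Henstock_Kurzweil_Integration.integral_nonneg) (auto intro: integrable_subinterval_real)
      then show ?thesis using integral_diff_Icc[OF gi, of c d] that x by auto
    qed
    show "norm (e d - e c) \<le> C * (integral {a..d} g - integral {a..c} g)\<^sup>2"
      if "a \<le> c" "c \<le> d" "d \<le> x" for c d
    proof -
      have "e d - e c = u d - u c - integral {c..d} w"
        using integral_diff_Icc[OF wi, of c d] that x by (simp add: e_def algebra_simps)
      then show ?thesis
        using inc[of c d] integral_diff_Icc[OF gi, of c d] that x by auto
    qed
  qed (use x in auto)
  then show "u x = u a + integral {a..x} w"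
    by (simp add: e_def algebra_simps)
qed

text \<open>With v frozen at d and u frozen at c, the increment of u v over [c, d] is exactly the
  integral of w v(d) + u(c) z. The integral K of |w| + |z| over [c, d] bounds the oscillation of
  both u and v there, so unfreezing costs at most K (|w| + |z|) pointwise and K^2 after
  integration.\<close>

lemma abs_cont_deriv_mult:
  assumes u: "abs_cont_deriv a b u w" and v: "abs_cont_deriv a b v z"
  shows "abs_cont_deriv a b (\<lambda>x. u x * v x) (\<lambda>x. w x * v x + u x * z x)"
proof (rule abs_cont_deriv_if_quadratic_increments[where g = "\<lambda>x. cmod (w x) + cmod (z x)" and C = 1])
  note cu = abs_cont_deriv_continuous[OF u] and cv = abs_cont_deriv_continuous[OF v]
  have w: "w absolutely_integrable_on {a..b}" and z: "z absolutely_integrable_on {a..b}"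
    by (intro abs_cont_deriv_integrable[OF u] abs_cont_deriv_integrable[OF v])+
  have wv: "(\<lambda>x. w x * v x) absolutely_integrable_on {a..b}"
    by (rule absolutely_integrable_mult_continuous[OF w cv])
  have uz: "(\<lambda>x. u x * z x) absolutely_integrable_on {a..b}"
    using absolutely_integrable_mult_continuous[OF z cu] by (simp add: mult.commute)
  show "(\<lambda>x. w x * v x + u x * z x) absolutely_integrable_on {a..b}"
    by (intro set_integral_add(1) wv uz)
  show "(\<lambda>x. cmod (w x) + cmod (z x)) absolutely_integrable_on {a..b}"
    by (intro set_integral_add(1) absolutely_integrable_norm[unfolded o_def] w z)
  fix c d assume cd: "a \<le> c" "c \<le> d" "d \<le> b"
  define K where "K = integral {c..d} (\<lambda>x. cmod (w x) + cmod (z x))"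
  note wi = abs_cont_deriv_integrable_sub[OF u cd(1,3)]
    and zi = abs_cont_deriv_integrable_sub[OF v cd(1,3)]
  have K: "integral {s..t} (\<lambda>x. cmod (w x)) \<le> K" "integral {s..t} (\<lambda>x. cmod (z x)) \<le> K"
    if "c \<le> s" "t \<le> d" for s t
  proof -
    have sub: "{s..t} \<subseteq> {c..d}" using that by auto
    have "integral {s..t} (\<lambda>x. cmod (w x)) \<le> integral {c..d} (\<lambda>x. cmod (w x))"
      "integral {s..t} (\<lambda>x. cmod (z x)) \<le> integral {c..d} (\<lambda>x. cmod (z x))"
      using integrable_subinterval_real[OF wi(3) sub] integrable_subinterval_real[OF zi(3) sub]
        wi(3) zi(3) by (intro integral_subset_le sub; simp)+
    moreover have "integral {c..d} (\<lambda>x. cmod (w x)) \<ge> 0" "integral {c..d} (\<lambda>x. cmod (z x)) \<ge> 0"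
      using wi(3) zi(3) by (intro Henstock_Kurzweil_Integration.integral_nonneg; simp)+
    moreover have "K = integral {c..d} (\<lambda>x. cmod (w x)) + integral {c..d} (\<lambda>x. cmod (z x))"
      unfolding K_def by (rule Henstock_Kurzweil_Integration.integral_add[OF wi(3) zi(3)])
    ultimately show "integral {s..t} (\<lambda>x. cmod (w x)) \<le> K" "integral {s..t} (\<lambda>x. cmod (z x)) \<le> K"
      by linarith+
  qed
  have K0: "K \<ge> 0"
    unfolding K_def using wi zi
    by (intro Henstock_Kurzweil_Integration.integral_nonneg integrable_add) auto
  have int: "(\<lambda>x. w x * v x + u x * z x) integrable_on {c..d}"
    using set_integral_add(1)[OF wv uz] cd
    by (auto simp: absolutely_integrable_on_def intro: integrable_subinterval_real)
  have "u d * v d - u c * v c = (u d - u c) * v d + u c * (v d - v c)"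
    by (simp add: algebra_simps)
  also have "\<dots> = integral {c..d} (\<lambda>x. w x * v d + u c * z x)"
    using wi zi
    by (subst Henstock_Kurzweil_Integration.integral_add)
      (auto simp: abs_cont_deriv_diff[OF u cd] abs_cont_deriv_diff[OF v cd]
        intro: integrable_on_cmult_left integrable_on_mult_left integrable_on_mult_right)
  finally have eq: "u d * v d - u c * v c - integral {c..d} (\<lambda>x. w x * v x + u x * z x)
    = integral {c..d} (\<lambda>x. (w x * v d + u c * z x) - (w x * v x + u x * z x))"
    using wi zi int
    by (subst Henstock_Kurzweil_Integration.integral_diff)
      (auto intro!: integrable_add integrable_on_mult_left integrable_on_mult_right)
  have "cmod (integral {c..d} (\<lambda>x. (w x * v d + u c * z x) - (w x * v x + u x * z x)))
    \<le> integral {c..d} (\<lambda>x. K * (cmod (w x) + cmod (z x)))"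
  proof (rule integral_norm_bound_integral)
    show "(\<lambda>x. (w x * v d + u c * z x) - (w x * v x + u x * z x)) integrable_on {c..d}"
      using wi zi int
      by (auto intro!: integrable_diff integrable_add integrable_on_mult_left integrable_on_mult_right)
    show "(\<lambda>x. K * (cmod (w x) + cmod (z x))) integrable_on {c..d}"
      using wi zi by (intro integrable_on_mult_right integrable_add)
    fix x assume x: "x \<in> {c..d}"
    have "cmod (v d - v x) \<le> K" "cmod (u x - u c) \<le> K"
      using abs_cont_deriv_norm_diff[OF v, of x d] abs_cont_deriv_norm_diff[OF u, of c x] x cd
        K(2)[of x d] K(1)[of c x] by auto
    moreover have "(w x * v d + u c * z x) - (w x * v x + u x * z x)
        = w x * (v d - v x) - (u x - u c) * z x"
      by (simp add: algebra_simps)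
    moreover have "cmod (w x * (v d - v x) - (u x - u c) * z x)
        \<le> cmod (w x) * cmod (v d - v x) + cmod (u x - u c) * cmod (z x)"
      using norm_triangle_ineq4[of "w x * (v d - v x)" "(u x - u c) * z x"] by (simp only: norm_mult)
    moreover have "cmod (w x) * cmod (v d - v x) \<le> cmod (w x) * K"
      "cmod (u x - u c) * cmod (z x) \<le> K * cmod (z x)"
      using calculation(1,2) by (auto intro: mult_left_mono mult_right_mono)
    ultimately show "cmod ((w x * v d + u c * z x) - (w x * v x + u x * z x))
        \<le> K * (cmod (w x) + cmod (z x))"
      by (simp only: distrib_left mult.commute[of "cmod (w x)" K])
  qed
  also have "\<dots> = 1 * K\<^sup>2"
    by (simp add: K_def power2_eq_square)
  finally show "cmod (u d * v d - u c * v c - integral {c..d} (\<lambda>x. w x * v x + u x * z x))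
    \<le> 1 * (integral {c..d} (\<lambda>x. cmod (w x) + cmod (z x)))\<^sup>2"
    unfolding eq K_def .
qed auto

lemma abs_cont_deriv_inverse:
  assumes u: "abs_cont_deriv a b u w" and nz: "\<And>x. x \<in> {a..b} \<Longrightarrow> u x \<noteq> 0"
  shows "abs_cont_deriv a b (\<lambda>x. 1 / u x) (\<lambda>x. - w x / (u x)\<^sup>2)"
proof -
  note cu = abs_cont_deriv_continuous[OF u]
  have w: "w absolutely_integrable_on {a..b}"
    by (rule abs_cont_deriv_integrable[OF u])
  have "bounded (u ` {a..b})" "bounded ((\<lambda>x. 1 / u x) ` {a..b})"
    using nz by (auto intro!: compact_imp_bounded compact_continuous_image continuous_intros cu)
  then obtain M m where M: "M > 0" "\<And>x. x \<in> {a..b} \<Longrightarrow> cmod (u x) \<le> M"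
    and m: "m > 0" "\<And>x. x \<in> {a..b} \<Longrightarrow> cmod (1 / u x) \<le> m"
    unfolding bounded_pos by (metis imageI)
  have "(\<lambda>x. w x * (- 1 / (u x)\<^sup>2)) absolutely_integrable_on {a..b}"
    using nz by (intro absolutely_integrable_mult_continuous[OF w] continuous_intros cu) auto
  then have int: "(\<lambda>x. - w x / (u x)\<^sup>2) absolutely_integrable_on {a..b}"
    by simp
  show ?thesis
  proof (rule abs_cont_deriv_if_quadratic_increments[where g = "\<lambda>x. cmod (w x)" and C = "2 * M * m ^ 4"])
    show "(\<lambda>x. cmod (w x)) absolutely_integrable_on {a..b}"
      by (intro absolutely_integrable_norm[unfolded o_def] w)
    fix c d assume cd: "a \<le> c" "c \<le> d" "d \<le> b"
    define K where "K = integral {c..d} (\<lambda>x. cmod (w x))"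
    note wi = abs_cont_deriv_integrable_sub[OF u cd(1,3)]
    have K: "integral {s..t} (\<lambda>x. cmod (w x)) \<le> K" if "c \<le> s" "t \<le> d" for s t
    proof -
      have sub: "{s..t} \<subseteq> {c..d}" using that by auto
      show ?thesis
        unfolding K_def using integrable_subinterval_real[OF wi(3) sub] wi(3)
        by (intro integral_subset_le sub) auto
    qed
    have K0: "K \<ge> 0"
      unfolding K_def using wi by (intro Henstock_Kurzweil_Integration.integral_nonneg) auto
    have int': "(\<lambda>x. - w x / (u x)\<^sup>2) integrable_on {c..d}"
      using int cd by (auto simp: absolutely_integrable_on_def intro: integrable_subinterval_real)
    have int'': "(\<lambda>x. w x * (- 1 / (u c * u d))) integrable_on {c..d}"
      by (intro integrable_on_mult_left wi)
    have "1 / u d - 1 / u c = (u d - u c) * (- 1 / (u c * u d))"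
      using nz[of c] nz[of d] cd by (simp add: field_simps)
    also have "\<dots> = integral {c..d} (\<lambda>x. w x * (- 1 / (u c * u d)))"
      unfolding abs_cont_deriv_diff[OF u cd] by simp
    finally have eq: "1 / u d - 1 / u c - integral {c..d} (\<lambda>x. - w x / (u x)\<^sup>2)
      = integral {c..d} (\<lambda>x. w x * (- 1 / (u c * u d)) - (- w x / (u x)\<^sup>2))"
      using int' int'' by (simp only: Henstock_Kurzweil_Integration.integral_diff)
    have "cmod (integral {c..d} (\<lambda>x. w x * (- 1 / (u c * u d)) - (- w x / (u x)\<^sup>2)))
      \<le> integral {c..d} (\<lambda>x. (2 * M * m ^ 4 * K) * cmod (w x))"
    proof (rule integral_norm_bound_integral)
      show "(\<lambda>x. (2 * M * m ^ 4 * K) * cmod (w x)) integrable_on {c..d}"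
        by (intro integrable_on_mult_right wi)
      fix x assume x: "x \<in> {c..d}"
      define r where "r = (\<lambda>t. 1 / u t)"
      have nz': "u x \<noteq> 0" "u c \<noteq> 0" "u d \<noteq> 0" using nz x cd by auto
      have r: "cmod (r x) \<le> m" "cmod (r c) \<le> m" "cmod (r d) \<le> m"
        unfolding r_def using m x cd by auto
      have ud: "cmod (u d - u x) \<le> K" "cmod (u x - u c) \<le> K"
        using abs_cont_deriv_norm_diff[OF u, of x d] abs_cont_deriv_norm_diff[OF u, of c x] x cd
          K[of x d] K[of c x] by auto
      \<comment> \<open>The numerator u(c) u(d) - u(x)^2 is split into two oscillations, each at
        most M K; the four reciprocals contribute m^4. This is the constant 2 M m^4.\<close>
      have "w x * (- 1 / (u c * u d)) - (- w x / (u x)\<^sup>2)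
        = w x * ((u c * (u d - u x) - u x * (u x - u c)) * (r x * r x * (r c * r d)))"
        using nz' by (simp add: field_simps power2_eq_square r_def)
      also have "cmod \<dots> = cmod (w x) * (cmod (u c * (u d - u x) - u x * (u x - u c)) *
           (cmod (r x) * cmod (r x) * (cmod (r c) * cmod (r d))))"
        by (simp add: norm_mult)
      also have "\<dots> \<le> cmod (w x) * ((M * K + M * K) * (m * m * (m * m)))"
      proof (intro mult_left_mono mult_mono)
        have "cmod (u c) \<le> M" "cmod (u x) \<le> M" using M(2) x cd by auto
        then have "cmod (u c * (u d - u x)) \<le> M * K" "cmod (u x * (u x - u c)) \<le> M * K"
          unfolding norm_mult using ud M(1) by (auto intro!: mult_mono)
        then show "cmod (u c * (u d - u x) - u x * (u x - u c)) \<le> M * K + M * K"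
          using norm_triangle_ineq4[of "u c * (u d - u x)" "u x * (u x - u c)"] by linarith
      qed (use r m(1) M(1) K0 in auto)
      finally show "cmod (w x * (- 1 / (u c * u d)) - (- w x / (u x)\<^sup>2))
        \<le> (2 * M * m ^ 4 * K) * cmod (w x)"
        by (simp add: algebra_simps power4_eq_xxxx)
    qed (rule integrable_diff[OF int'' int'])
    also have "\<dots> = 2 * M * m ^ 4 * K\<^sup>2"
      by (simp add: K_def power2_eq_square)
    finally show "cmod (1 / u d - 1 / u c - integral {c..d} (\<lambda>x. - w x / (u x)\<^sup>2))
      \<le> 2 * M * m ^ 4 * (integral {c..d} (\<lambda>x. cmod (w x)))\<^sup>2"
      unfolding eq K_def .
  qed (use int in auto)
qed

lemma abs_cont_deriv_diff_fun:
  assumes u: "abs_cont_deriv a b u w" and v: "abs_cont_deriv a b v z"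
  shows "abs_cont_deriv a b (\<lambda>x. u x - v x) (\<lambda>x. w x - z x)"
  unfolding abs_cont_deriv_def
proof (intro conjI ballI)
  show "(\<lambda>x. w x - z x) absolutely_integrable_on {a..b}"
    by (intro set_integral_diff(1) abs_cont_deriv_integrable[OF u] abs_cont_deriv_integrable[OF v])
  fix x assume "x \<in> {a..b}"
  then show "u x - v x = u a - v a + integral {a..x} (\<lambda>x. w x - z x)"
    using abs_cont_deriv_diff[OF u, of a x] abs_cont_deriv_diff[OF v, of a x]
      abs_cont_deriv_integrable_sub[OF u, of a x] abs_cont_deriv_integrable_sub[OF v, of a x]
    by (auto simp: Henstock_Kurzweil_Integration.integral_diff algebra_simps)
qed

lemma abs_cont_deriv_smooth:
  assumes "smooth u"
  shows "abs_cont_deriv a b u (\<lambda>x. vector_derivative u (at x))"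
  unfolding abs_cont_deriv_def
proof (intro conjI ballI)
  show "(\<lambda>x. vector_derivative u (at x)) absolutely_integrable_on {a..b}"
    by (intro absolutely_integrable_continuous_real smooth_continuous_on smooth_vector_derivative assms)
  fix x assume "x \<in> {a..b}"
  then have "((\<lambda>x. vector_derivative u (at x)) has_integral (u x - u a)) {a..x}"
    by (intro fundamental_theorem_of_calculus)
      (auto intro: has_vector_derivative_at_within smooth_has_vector_derivative[OF assms])
  then show "u x = u a + integral {a..x} (\<lambda>x. vector_derivative u (at x))"
    by (simp add: integral_unique)
qed

lemma abs_cont_deriv_primitive:
  assumes "w absolutely_integrable_on {a..b}"
  shows "abs_cont_deriv a b (\<lambda>x. integral {a..x} w) w"
  using assms by (auto simp: abs_cont_deriv_def)

lemma abs_cont_deriv_add_const: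
  assumes "abs_cont_deriv a b u w"
  shows "abs_cont_deriv a b (\<lambda>x. u x + c) w"
  unfolding abs_cont_deriv_def
  using abs_cont_deriv_integrable[OF assms] abs_cont_deriv_eq[OF assms]
  by (metis add.assoc add.commute)

section \<open>Weak derivatives\<close>

text \<open>Bridge between the two integrals in use: the definitions integrate over the open
  interval with respect to Lebesgue measure, primitives are gauge integrals over closed intervals.
  The endpoints are negligible.\<close>

lemma integrable_lebesgue_on_Ioo_iff:
  fixes w :: "real \<Rightarrow> complex"
  shows "integrable (lebesgue_on {a<..<b}) w \<longleftrightarrow> w absolutely_integrable_on {a..b}"
proof -
  have "integrable (lebesgue_on {a<..<b}) w \<longleftrightarrow> w absolutely_integrable_on {a<..<b}"
    by (simp add: set_integrable_def integrable_restrict_space)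
  then show ?thesis
    using absolutely_integrable_on_Icc_iff_Ioo by blast
qed

lemma lebesgue_integral_Ioo:
  fixes w :: "real \<Rightarrow> complex"
  assumes "integrable (lebesgue_on {a<..<b}) w"
  shows "(LINT x|lebesgue_on {a<..<b}. w x) = integral {a..b} w"
  using lebesgue_integral_eq_integral[OF assms] by (simp add: integral_open_interval_real)

text \<open>Countably many compactly contained intervals exhaust (a, b). Locally integrable
  functions are integrable only on such subintervals.\<close>

lemma AE_lebesgue_on_Ioo_approx:
  assumes "\<And>c d. a < c \<Longrightarrow> c < d \<Longrightarrow> d < b \<Longrightarrow> AE x in lebesgue_on {c<..<d}. P x"
  shows "AE x in lebesgue_on {a<..<b::real}. P x"
proof -
  have "AE x in lebesgue. x \<in> {a + 1 / real (Suc n)<..<b - 1 / real (Suc n)} \<longrightarrow> P x" for n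
  proof (cases "a + 1 / real (Suc n) < b - 1 / real (Suc n)")
    case True
    have "1 / real (Suc n) > 0" by simp
    then have "AE x in lebesgue_on {a + 1 / real (Suc n)<..<b - 1 / real (Suc n)}. P x"
      using True by (intro assms) linarith+
    then show ?thesis by (subst (asm) AE_restrict_space_iff) auto
  next
    case False
    then have "{a + 1 / real (Suc n)<..<b - 1 / real (Suc n)} = {}"
      by (intro greaterThanLessThan_empty) linarith
    then show ?thesis by simp
  qed
  then have "AE x in lebesgue. \<forall>n. x \<in> {a + 1 / real (Suc n)<..<b - 1 / real (Suc n)} \<longrightarrow> P x"
    by (subst AE_all_countable) blast
  then have "AE x in lebesgue. x \<in> {a<..<b} \<longrightarrow> P x"
  proof eventually_elim
    case (elim x)
    show ?case
    proof
      assume x: "x \<in> {a<..<b}"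
      then obtain n where "1 / real (Suc n) < min (x - a) (b - x)"
        using nat_approx_posE[of "min (x - a) (b - x)"] by auto
      then have "x \<in> {a + 1 / real (Suc n)<..<b - 1 / real (Suc n)}"
        unfolding greaterThanLessThan_iff by linarith
      then show "P x" using elim by blast
    qed
  qed
  then show ?thesis by (subst AE_restrict_space_iff) auto
qed

text \<open>The truncations of u to an exhausting sequence of compact intervals converge to u
  pointwise. This is the source of measurability for \<open>wderiv\<close>, about which nothing is
  known beyond \<open>has_weak_deriv\<close>.\<close>

lemma locally_integrable_measurable:
  assumes "locally_integrable {a<..<b} u"
  shows "u \<in> borel_measurable (lebesgue_on {a<..<b})"
proof -
  define K where "K = (\<lambda>n. {a + 1 / real (Suc n)..b - 1 / real (Suc n)})"
  have K: "K n \<subseteq> {a<..<b}" for n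
  proof -
    have "1 / real (Suc n) > 0" by simp
    then show ?thesis
      unfolding K_def subset_iff atLeastAtMost_iff greaterThanLessThan_iff
      by (intro allI impI) linarith
  qed
  show ?thesis
  proof (rule borel_measurable_LIMSEQ_metric)
    fix n
    have "compact (K n)" by (simp add: K_def)
    then have "integrable (lebesgue_on (K n)) u"
      using assms K unfolding locally_integrable_def by blast
    then have "u \<in> borel_measurable (lebesgue_on (K n))" by simp
    moreover have "K n \<in> sets lebesgue" by (simp add: K_def)
    ultimately show "(\<lambda>x. if x \<in> K n then u x else 0) \<in> borel_measurable (lebesgue_on {a<..<b})"
      using K by (subst borel_measurable_if_lebesgue_on) auto
  next
    fix x assume "x \<in> space (lebesgue_on {a<..<b})"
    then have x: "x \<in> {a<..<b}" by simp
    then obtain N where N: "1 / real (Suc N) < min (x - a) (b - x)"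
      using nat_approx_posE[of "min (x - a) (b - x)"] by auto
    have "x \<in> K n" if "n \<ge> N" for n
    proof -
      have "1 / real (Suc n) \<le> 1 / real (Suc N)" using that by (simp add: field_simps)
      then show ?thesis using N unfolding K_def atLeastAtMost_iff by linarith
    qed
    then have "eventually (\<lambda>n. (if x \<in> K n then u x else 0) = u x) sequentially"
      by (auto simp: eventually_sequentially)
    then show "(\<lambda>n. if x \<in> K n then u x else 0) \<longlonglongrightarrow> u x"
      by (rule tendsto_eventually)
  qed
qed

lemma integrable_imp_locally_integrable:
  assumes "integrable (lebesgue_on J) u" "J \<in> sets lebesgue"
  shows "locally_integrable J u"
  unfolding locally_integrable_def
proof (intro allI impI)
  fix K assume K: "K \<subseteq> J" "compact K"
  then have [simp]: "K \<in> sets lebesgue"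
    using lmeasurable_compact fmeasurableD by blast
  have "integrable lebesgue (\<lambda>x. indicat_real J x *\<^sub>R u x)"
    using assms by (simp add: integrable_restrict_space)
  then have "integrable lebesgue (\<lambda>x. indicat_real K x *\<^sub>R (indicat_real J x *\<^sub>R u x))"
    by (rule integrable_mult_indicator[rotated]) simp
  also have "(\<lambda>x. indicat_real K x *\<^sub>R (indicat_real J x *\<^sub>R u x)) = (\<lambda>x. indicat_real K x *\<^sub>R u x)"
    using K by (auto simp: indicator_def fun_eq_iff)
  finally show "integrable (lebesgue_on K) u"
    by (simp add: integrable_restrict_space)
qed

lemma locally_integrable_diff:
  "locally_integrable J u \<Longrightarrow> locally_integrable J v \<Longrightarrow> locally_integrable J (\<lambda>x. u x - v x)"
  by (auto simp: locally_integrable_def)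

lemma locally_integrable_mult_test_fun:
  assumes "locally_integrable {a<..<b} u" "\<phi> \<in> test_fun {a<..<b}" "a < b"
  shows "integrable (lebesgue_on {a<..<b}) (\<lambda>x. u x * \<phi> x)"
proof -
  obtain c d where cd: "a < c" "c \<le> d" "d < b" "\<And>x. \<phi> x \<noteq> 0 \<Longrightarrow> x \<in> {c..d}"
    using test_fun_support assms(2,3) by metis
  obtain C where C: "C > 0" "\<And>x. cmod (\<phi> x) \<le> C"
    using test_fun_bounded assms(2,3) by metis
  have "{c..d} \<subseteq> {a<..<b}" using cd by auto
  then have u: "integrable (lebesgue_on {c..d}) u"
    using assms(1) by (simp add: locally_integrable_def)
  have "integrable (lebesgue_on {c..d}) (\<lambda>x. u x * \<phi> x)"
  proof (rule Bochner_Integration.integrable_bound)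
    show "integrable (lebesgue_on {c..d}) (\<lambda>x. C * norm (u x))" using u by auto
    show "AE x in lebesgue_on {c..d}. norm (u x * \<phi> x) \<le> norm (C * norm (u x))"
      using C by (auto intro!: AE_I2 simp: norm_mult mult.commute[of C] mult_left_mono)
  qed (use u test_fun_measurable[OF assms(2)] in auto)
  then have "integrable lebesgue (\<lambda>x. indicat_real {c..d} x *\<^sub>R (u x * \<phi> x))"
    by (simp add: integrable_restrict_space)
  also have "(\<lambda>x. indicat_real {c..d} x *\<^sub>R (u x * \<phi> x)) = (\<lambda>x. indicat_real {a<..<b} x *\<^sub>R (u x * \<phi> x))"
  proof
    fix x
    show "indicat_real {c..d} x *\<^sub>R (u x * \<phi> x) = indicat_real {a<..<b} x *\<^sub>R (u x * \<phi> x)"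
      using cd(1-3) cd(4)[of x] by (cases "\<phi> x = 0") (auto simp: indicator_def)
  qed
  finally show ?thesis by (simp add: integrable_restrict_space)
qed

text \<open>On a compactly contained subinterval w is integrable, and the test functions of the
  subinterval are also test functions of (a, b), so the fundamental lemma applies there.\<close>

lemma AE_zero_if_locally_orthogonal_test_fun:
  assumes loc: "locally_integrable {a<..<b} w"
    and orth: "\<And>\<phi>. \<phi> \<in> test_fun {a<..<b} \<Longrightarrow> (LINT x|lebesgue_on {a<..<b}. w x * \<phi> x) = 0"
  shows "AE x in lebesgue_on {a<..<b}. w x = 0"
proof (rule AE_lebesgue_on_Ioo_approx)
  fix c d assume cd: "a < c" "c < d" "d < b"
  show "AE x in lebesgue_on {c<..<d}. w x = 0"
  proof (rule AE_zero_if_orthogonal_test_fun)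
    have "{c..d} \<subseteq> {a<..<b}" using cd by auto
    then have "integrable (lebesgue_on {c..d}) w"
      using loc by (simp add: locally_integrable_def)
    then have "w absolutely_integrable_on {c..d}"
      by (simp add: set_integrable_def integrable_restrict_space)
    then show "integrable (lebesgue_on {c<..<d}) w"
      by (simp add: integrable_lebesgue_on_Ioo_iff)
    fix \<phi> assume \<phi>: "\<phi> \<in> test_fun {c<..<d}"
    obtain c' d' where c'd': "c < c'" "c' \<le> d'" "d' < d" "\<And>x. \<phi> x \<noteq> 0 \<Longrightarrow> x \<in> {c'..d'}"
      using test_fun_support[OF \<phi> cd(2)] by metis
    have "(\<lambda>x. indicat_real {c<..<d} x *\<^sub>R (w x * \<phi> x)) = (\<lambda>x. indicat_real {a<..<b} x *\<^sub>R (w x * \<phi> x))"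
    proof
      fix x
      show "indicat_real {c<..<d} x *\<^sub>R (w x * \<phi> x) = indicat_real {a<..<b} x *\<^sub>R (w x * \<phi> x)"
        using c'd'(1-3) c'd'(4)[of x] cd by (cases "\<phi> x = 0") (auto simp: indicator_def)
    qed
    then have "(LINT x|lebesgue_on {c<..<d}. w x * \<phi> x) = (LINT x|lebesgue_on {a<..<b}. w x * \<phi> x)"
      by (simp add: integral_restrict_space)
    also have "\<dots> = 0"
      using \<phi> cd by (intro orth test_fun_subset[OF \<phi>]) auto
    finally show "(LINT x|lebesgue_on {c<..<d}. w x * \<phi> x) = 0" .
  qed
qed

lemma test_fun_vector_derivative:
  assumes "\<phi> \<in> test_fun {a<..<b}" "a < b"
  shows "(\<lambda>x. vector_derivative \<phi> (at x)) \<in> test_fun {a<..<b}"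
proof -
  obtain c d where cd: "a < c" "c \<le> d" "d < b" "\<And>x. \<phi> x \<noteq> 0 \<Longrightarrow> x \<in> {c..d}"
    using test_fun_support assms by metis
  show ?thesis
  proof (rule test_funI[of _ c d])
    show "smooth (\<lambda>x. vector_derivative \<phi> (at x))"
      by (intro smooth_vector_derivative test_fun_smooth[OF assms(1)])
    show "x \<in> {c..d}" if nz: "vector_derivative \<phi> (at x) \<noteq> 0" for x
    proof (rule ccontr)
      assume x: "x \<notin> {c..d}"
      have "((\<lambda>x. 0) has_vector_derivative 0) (at x)" by simp
      then have "(\<phi> has_vector_derivative 0) (at x)"
        by (rule has_vector_derivative_transform_within_open[where S = "- {c..d}"])
          (use x cd(4) in \<open>auto simp: open_Compl\<close>)
      then show False using nz by (simp add: vector_derivative_at)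
    qed
  qed (use cd in auto)
qed

lemma has_weak_deriv_unique:
  assumes "has_weak_deriv {a<..<b} u w" "has_weak_deriv {a<..<b} u z" "a < b"
  shows "AE x in lebesgue_on {a<..<b}. w x = z x"
proof -
  have "AE x in lebesgue_on {a<..<b}. w x - z x = 0"
  proof (rule AE_zero_if_locally_orthogonal_test_fun)
    show "locally_integrable {a<..<b} (\<lambda>x. w x - z x)"
      using assms by (auto simp: has_weak_deriv_def intro: locally_integrable_diff)
    fix \<phi> assume \<phi>: "\<phi> \<in> test_fun {a<..<b}"
    have "(LINT x|lebesgue_on {a<..<b}. w x * \<phi> x) = (LINT x|lebesgue_on {a<..<b}. z x * \<phi> x)"
      using assms \<phi> unfolding has_weak_deriv_def by (metis neg_equal_iff_equal)
    moreover have "integrable (lebesgue_on {a<..<b}) (\<lambda>x. w x * \<phi> x)"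
      "integrable (lebesgue_on {a<..<b}) (\<lambda>x. z x * \<phi> x)"
      using assms \<phi> by (auto simp: has_weak_deriv_def intro!: locally_integrable_mult_test_fun)
    ultimately show "(LINT x|lebesgue_on {a<..<b}. (w x - z x) * \<phi> x) = 0"
      by (simp add: left_diff_distrib)
  qed
  then show ?thesis by simp
qed

text \<open>Once some weak derivative exists the choice behind \<open>wderiv\<close> is one too, and
  uniqueness compares the two.\<close>

lemma wderiv_AE_eq:
  assumes "has_weak_deriv {a<..<b} u w" "a < b"
  shows "AE x in lebesgue_on {a<..<b}. wderiv {a<..<b} u x = w x"
proof -
  have "has_weak_deriv {a<..<b} u (wderiv {a<..<b} u)"
    unfolding wderiv_def by (rule someI[of "has_weak_deriv {a<..<b} u" w]) (rule assms(1))
  then show ?thesis using assms has_weak_deriv_unique by blast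
qed

lemma locally_integrable_cong_AE:
  assumes "locally_integrable J u" "v \<in> borel_measurable (lebesgue_on J)" "J \<in> sets lebesgue"
    and ae: "AE x in lebesgue_on J. u x = v x"
  shows "locally_integrable J v"
  unfolding locally_integrable_def
proof (intro allI impI)
  fix K assume K: "K \<subseteq> J" "compact K"
  have Ks: "K \<in> sets lebesgue"
    using K(2) lmeasurable_compact fmeasurableD by blast
  have u: "integrable (lebesgue_on K) u"
    using assms(1) K by (simp add: locally_integrable_def)
  have "AE x in lebesgue. x \<in> J \<longrightarrow> u x = v x"
    using ae assms(3) by (subst (asm) AE_restrict_space_iff) auto
  then have "AE x in lebesgue. x \<in> K \<longrightarrow> u x = v x"
    by (rule eventually_mono) (use K in auto)
  then have "AE x in lebesgue_on K. u x = v x"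
    using Ks by (subst AE_restrict_space_iff) auto
  moreover have "v \<in> borel_measurable (lebesgue_on K)"
    using assms(2,3) K(1) Ks by (rule_tac measurable_restrict_mono)
  ultimately show "integrable (lebesgue_on K) v"
    using u integrable_cong_AE_imp by (metis (mono_tags, lifting) eventually_mono)
qed

lemma has_weak_deriv_cong_AE:
  assumes "has_weak_deriv {a<..<b} u w"
    and u': "u' \<in> borel_measurable (lebesgue_on {a<..<b})" "AE x in lebesgue_on {a<..<b}. u x = u' x"
    and w': "w' \<in> borel_measurable (lebesgue_on {a<..<b})" "AE x in lebesgue_on {a<..<b}. w x = w' x"
    and "a < b"
  shows "has_weak_deriv {a<..<b} u' w'"
  unfolding has_weak_deriv_def
proof (intro conjI ballI)
  have loc: "locally_integrable {a<..<b} u" "locally_integrable {a<..<b} w"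
    using assms(1) by (auto simp: has_weak_deriv_def)
  then show "locally_integrable {a<..<b} u'" "locally_integrable {a<..<b} w'"
    using u' w' by (auto intro: locally_integrable_cong_AE)
  note m = loc[THEN locally_integrable_measurable]
  fix \<phi> assume \<phi>: "\<phi> \<in> test_fun {a<..<b}"
  note \<phi>m = test_fun_measurable[OF \<phi>] test_fun_measurable[OF test_fun_vector_derivative[OF \<phi> \<open>a < b\<close>]]
  have "(LINT x|lebesgue_on {a<..<b}. u' x * vector_derivative \<phi> (at x))
    = (LINT x|lebesgue_on {a<..<b}. u x * vector_derivative \<phi> (at x))"
    by (rule integral_cong_AE) (use u' m \<phi>m in auto)
  moreover have "(LINT x|lebesgue_on {a<..<b}. w' x * \<phi> x) = (LINT x|lebesgue_on {a<..<b}. w x * \<phi> x)"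
    by (rule integral_cong_AE) (use w' m \<phi>m in auto)
  ultimately show "(LINT x|lebesgue_on {a<..<b}. u' x * vector_derivative \<phi> (at x))
    = - (LINT x|lebesgue_on {a<..<b}. w' x * \<phi> x)"
    using assms(1) \<phi> by (simp add: has_weak_deriv_def)
qed

lemma abs_cont_deriv_lebesgue_integrable:
  assumes "abs_cont_deriv a b u w"
  shows "integrable (lebesgue_on {a<..<b}) u" "integrable (lebesgue_on {a<..<b}) w"
  using abs_cont_deriv_integrable[OF assms]
    absolutely_integrable_continuous_real[OF abs_cont_deriv_continuous[OF assms]]
  by (simp_all add: integrable_lebesgue_on_Ioo_iff)

text \<open>Integration by parts: the product rule for u \<phi> is integrated over [a, b], and the
  boundary values vanish with \<phi>.\<close>

lemma abs_cont_deriv_imp_has_weak_deriv: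
  assumes u: "abs_cont_deriv a b u w" and "a < b"
  shows "has_weak_deriv {a<..<b} u w"
  unfolding has_weak_deriv_def
proof (intro conjI ballI)
  show loc: "locally_integrable {a<..<b} u" "locally_integrable {a<..<b} w"
    by (intro integrable_imp_locally_integrable abs_cont_deriv_lebesgue_integrable[OF u]; simp)+
  fix \<phi> assume \<phi>: "\<phi> \<in> test_fun {a<..<b}"
  note \<phi>' = test_fun_vector_derivative[OF \<phi> \<open>a < b\<close>]
  have int: "integrable (lebesgue_on {a<..<b}) (\<lambda>x. u x * vector_derivative \<phi> (at x))"
    "integrable (lebesgue_on {a<..<b}) (\<lambda>x. w x * \<phi> x)"
    using loc \<phi> \<phi>' \<open>a < b\<close> by (auto intro: locally_integrable_mult_test_fun)
  obtain c d where cd: "a < c" "c \<le> d" "d < b" "\<And>x. \<phi> x \<noteq> 0 \<Longrightarrow> x \<in> {c..d}"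
    using test_fun_support[OF \<phi> \<open>a < b\<close>] by metis
  have \<phi>0: "\<phi> a = 0" "\<phi> b = 0" using cd(1-3) cd(4)[of a] cd(4)[of b] by auto
  have "integral {a..b} (\<lambda>x. w x * \<phi> x + u x * vector_derivative \<phi> (at x)) = 0"
    using abs_cont_deriv_diff[OF abs_cont_deriv_mult[OF u abs_cont_deriv_smooth[OF test_fun_smooth[OF \<phi>]]], of a b]
      \<phi>0 \<open>a < b\<close> by simp
  then have "(LINT x|lebesgue_on {a<..<b}. w x * \<phi> x + u x * vector_derivative \<phi> (at x)) = 0"
    using int by (subst lebesgue_integral_Ioo) auto
  then show "(LINT x|lebesgue_on {a<..<b}. u x * vector_derivative \<phi> (at x))
      = - (LINT x|lebesgue_on {a<..<b}. w x * \<phi> x)"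
    using int by (simp add: eq_neg_iff_add_eq_0 add.commute)
qed

text \<open>If every test function had integral 0, the constant 1 would be orthogonal to all of them
  and hence 0 almost everywhere. A test function with nonzero integral is then rescaled.\<close>

lemma test_fun_integral_one:
  assumes "a < b"
  obtains \<rho> where "\<rho> \<in> test_fun {a<..<b}" "integral {a..b} \<rho> = 1"
proof -
  have "\<exists>\<phi>\<in>test_fun {a<..<b}. (LINT x|lebesgue_on {a<..<b}. 1 * \<phi> x) \<noteq> 0"
  proof (rule ccontr)
    assume "\<not> ?thesis"
    then have "AE x in lebesgue_on {a<..<b}. (1::complex) = 0"
      by (intro AE_zero_if_orthogonal_test_fun)
        (auto intro: integrable_const_lebesgue_on_Ioo)
    then have "AE x in lebesgue. x \<notin> {a<..<b}"
      by (subst (asm) AE_restrict_space_iff) auto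
    then have "{a<..<b} \<in> null_sets lebesgue"
      by (subst (asm) AE_iff_null_sets[symmetric]) auto
    then have "emeasure lborel {a<..<b} = 0" by auto
    then show False using assms by simp
  qed
  then obtain \<phi> where \<phi>: "\<phi> \<in> test_fun {a<..<b}" "(LINT x|lebesgue_on {a<..<b}. \<phi> x) \<noteq> 0"
    by auto
  then have nz: "integral {a..b} \<phi> \<noteq> 0"
    using lebesgue_integral_Ioo[OF Lp2_imp_integrable[OF test_fun_Lp2[OF \<phi>(1) assms]]] by simp
  show thesis
  proof
    show "(\<lambda>x. 1 / integral {a..b} \<phi> * \<phi> x) \<in> test_fun {a<..<b}"
      by (intro test_fun_mult \<phi>(1) smooth_const assms)
    show "integral {a..b} (\<lambda>x. 1 / integral {a..b} \<phi> * \<phi> x) = 1"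
      using nz by simp
  qed
qed

text \<open>Du Bois-Reymond: test functions of the form \<open>\<psi> - (\<integral>\<psi>) \<rho>\<close> with \<open>\<integral>\<rho> = 1\<close> are exactly the
  derivatives of test functions, so a function with vanishing weak derivative is constant.\<close>

lemma has_weak_deriv_imp_abs_cont_deriv:
  assumes u: "has_weak_deriv {a<..<b} u w" and w: "integrable (lebesgue_on {a<..<b}) w" and "a < b"
  obtains U where "abs_cont_deriv a b U w" "AE x in lebesgue_on {a<..<b}. u x = U x"
proof -
  let ?M = "lebesgue_on {a<..<b}"
  define U0 where "U0 = (\<lambda>x. integral {a..x} w)"
  have U0: "abs_cont_deriv a b U0 w"
    unfolding U0_def using w by (intro abs_cont_deriv_primitive) (simp add: integrable_lebesgue_on_Ioo_iff)
  note wU0 = abs_cont_deriv_imp_has_weak_deriv[OF U0 \<open>a < b\<close>]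
  define D where "D = (\<lambda>x. u x - U0 x)"
  have loc: "locally_integrable {a<..<b} u" "locally_integrable {a<..<b} U0" "locally_integrable {a<..<b} D"
    using u wU0 by (auto simp: has_weak_deriv_def D_def intro: locally_integrable_diff)
  have D: "(LINT x|?M. D x * vector_derivative \<phi> (at x)) = 0" if \<phi>: "\<phi> \<in> test_fun {a<..<b}" for \<phi>
  proof -
    have "(LINT x|?M. u x * vector_derivative \<phi> (at x)) = (LINT x|?M. U0 x * vector_derivative \<phi> (at x))"
      using u wU0 \<phi> by (simp add: has_weak_deriv_def)
    then show ?thesis
      using locally_integrable_mult_test_fun[OF loc(1) test_fun_vector_derivative[OF \<phi> \<open>a < b\<close>] \<open>a < b\<close>]
        locally_integrable_mult_test_fun[OF loc(2) test_fun_vector_derivative[OF \<phi> \<open>a < b\<close>] \<open>a < b\<close>]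
      by (simp add: D_def left_diff_distrib)
  qed
  obtain \<rho> where \<rho>: "\<rho> \<in> test_fun {a<..<b}" "integral {a..b} \<rho> = 1"
    using test_fun_integral_one[OF \<open>a < b\<close>] by metis
  \<comment> \<open>This is the only possible value of the constant, as \<rho> has integral 1. For
    \<theta> = \<psi> - m \<rho> with m the integral of \<psi>, the integral of D \<theta> is 0, so
    that of D \<psi> equals m c, which is the integral of c \<psi>.\<close>
  define c where "c = (LINT x|?M. D x * \<rho> x)"
  have "AE x in ?M. D x - c = 0"
  proof (rule AE_zero_if_locally_orthogonal_test_fun)
    have "locally_integrable {a<..<b} (\<lambda>x. c)"
      by (intro integrable_imp_locally_integrable integrable_const_lebesgue_on_Ioo) auto
    then show "locally_integrable {a<..<b} (\<lambda>x. D x - c)"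
      using loc(3) by (rule locally_integrable_diff[rotated])
    fix \<psi> assume \<psi>: "\<psi> \<in> test_fun {a<..<b}"
    define m where "m = integral {a..b} \<psi>"
    have int: "integrable ?M (\<lambda>x. \<psi> x)" "integrable ?M \<rho>"
      by (intro Lp2_imp_integrable test_fun_Lp2 \<psi> \<rho>(1) \<open>a < b\<close>)+
    then have inth: "\<psi> integrable_on {a..b}" "\<rho> integrable_on {a..b}"
      by (simp_all add: integrable_lebesgue_on_Ioo_iff absolutely_integrable_on_def)
    define \<theta> where "\<theta> = (\<lambda>x. \<psi> x + - m * \<rho> x)"
    have \<theta>: "\<theta> \<in> test_fun {a<..<b}"
      unfolding \<theta>_def by (intro test_fun_add test_fun_mult \<psi> \<rho>(1) \<open>a < b\<close> smooth_const)
    have "integral {a..b} \<theta> = 0"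
      unfolding \<theta>_def using inth \<rho>(2)
      by (subst Henstock_Kurzweil_Integration.integral_add)
        (auto simp: m_def intro!: integrable_neg integrable_on_mult_right)
    then have P: "(\<lambda>x. integral {a..x} \<theta>) \<in> test_fun {a<..<b}"
      by (intro test_fun_primitive \<theta> \<open>a < b\<close>)
    have "vector_derivative (\<lambda>x. integral {a..x} \<theta>) (at x) = \<theta> x" for x
    proof (intro vector_derivative_at has_vector_derivative_primitive)
      show "continuous_on UNIV \<theta>" by (intro smooth_continuous_on test_fun_smooth[OF \<theta>])
      show "\<theta> x = 0" if "x \<le> a" for x
        using test_fun_support[OF \<theta> \<open>a < b\<close>] that by (metis atLeastAtMost_iff not_le order_trans)
    qed
    then have "(LINT x|?M. D x * \<theta> x) = 0" using D[OF P] by simp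
    moreover have "integrable ?M (\<lambda>x. D x * \<psi> x)" "integrable ?M (\<lambda>x. D x * \<rho> x)"
      by (intro locally_integrable_mult_test_fun loc \<psi> \<rho> \<open>a < b\<close>)+
    moreover have "(LINT x|?M. \<psi> x) = m"
      using lebesgue_integral_Ioo[OF int(1)] by (simp add: m_def)
    ultimately show "(LINT x|?M. (D x - c) * \<psi> x) = 0"
      using int by (simp add: \<theta>_def c_def algebra_simps)
  qed
  then have "AE x in ?M. u x = U0 x + c"
    by (rule eventually_mono) (simp add: D_def algebra_simps)
  then show thesis
    using that[OF abs_cont_deriv_add_const[OF U0, of c]] by simp
qed

section \<open>The space \<open>W\<^sup>1\<^sup>,\<^sup>2\<close> on an interval\<close>

lemma sobolev_1: "sobolev 1 p J = {u \<in> Lp p J. \<exists>w\<in>Lp p J. has_weak_deriv J u w}"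
  by simp

lemma Lp2_imp_Lp1:
  assumes "u \<in> Lp 2 {a<..<b}"
  shows "u \<in> Lp 1 {a<..<b}"
proof -
  have "integrable (lebesgue_on {a<..<b}) (\<lambda>x. cmod (u x))"
    by (intro integrable_norm Lp2_imp_integrable assms)
  then show ?thesis
    using Lp2D(1)[OF assms] by (simp add: Lp_def)
qed

lemma Lp2_cong_AE:
  assumes "u \<in> Lp 2 J" "v \<in> borel_measurable (lebesgue_on J)" "AE x in lebesgue_on J. u x = v x"
  shows "v \<in> Lp 2 J"
  by (rule Lp2_bound[OF assms(2) Lp2D(2)[OF assms(1)]]) (use assms(3) in \<open>auto elim: eventually_mono\<close>)

text \<open>\<open>U\<close> is the absolutely continuous representative of \<open>u\<close>, and \<open>w\<close> its derivative.\<close>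

definition W12_repr :: "real \<Rightarrow> real \<Rightarrow> (real \<Rightarrow> complex) \<Rightarrow> (real \<Rightarrow> complex) \<Rightarrow> (real \<Rightarrow> complex) \<Rightarrow> bool" where
  "W12_repr a b u U w \<longleftrightarrow> u \<in> borel_measurable (lebesgue_on {a<..<b}) \<and>
    (AE x in lebesgue_on {a<..<b}. u x = U x) \<and> abs_cont_deriv a b U w \<and> w \<in> Lp 2 {a<..<b}"

lemma abs_cont_deriv_measurable:
  assumes "abs_cont_deriv a b U w"
  shows "U \<in> borel_measurable (lebesgue_on {a<..<b})"
  using abs_cont_deriv_lebesgue_integrable(1)[OF assms] by simp

lemma abs_cont_deriv_bounded:
  assumes "abs_cont_deriv a b U w"
  obtains C where "\<And>x. x \<in> {a<..<b} \<Longrightarrow> cmod (U x) \<le> C"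
proof -
  have "bounded (U ` {a..b})"
    by (intro compact_imp_bounded compact_continuous_image abs_cont_deriv_continuous[OF assms]) auto
  then obtain C where "\<forall>x\<in>{a..b}. cmod (U x) \<le> C"
    unfolding bounded_iff by auto
  then show thesis using that[of C] by auto
qed

lemma abs_cont_deriv_Lp2: "abs_cont_deriv a b U w \<Longrightarrow> U \<in> Lp 2 {a<..<b}"
  by (metis abs_cont_deriv_bounded abs_cont_deriv_measurable Lp2_bounded)

lemma abs_cont_deriv_mult_Lp2:
  assumes "abs_cont_deriv a b U w" "z \<in> Lp 2 {a<..<b}"
  shows "(\<lambda>x. U x * z x) \<in> Lp 2 {a<..<b}"
  by (metis abs_cont_deriv_bounded abs_cont_deriv_measurable Lp2_bounded_mult assms)

lemma W12_repr_refl: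
  "abs_cont_deriv a b U w \<Longrightarrow> w \<in> Lp 2 {a<..<b} \<Longrightarrow> W12_repr a b U U w"
  by (simp add: W12_repr_def abs_cont_deriv_measurable)

lemma W12_repr_has_weak_deriv:
  assumes "W12_repr a b u U w" "a < b"
  shows "has_weak_deriv {a<..<b} u w"
proof (rule has_weak_deriv_cong_AE[OF abs_cont_deriv_imp_has_weak_deriv])
  show "AE x in lebesgue_on {a<..<b}. U x = u x"
    using assms(1) by (auto simp: W12_repr_def elim: eventually_mono)
qed (use assms in \<open>auto simp: W12_repr_def Lp_def\<close>)

lemma W12_repr_sobolev:
  assumes "W12_repr a b u U w" "a < b"
  shows "u \<in> sobolev 1 2 {a<..<b}"
proof -
  have "u \<in> Lp 2 {a<..<b}"
    by (rule Lp2_cong_AE[of U])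
      (use assms(1) abs_cont_deriv_Lp2 in \<open>auto simp: W12_repr_def elim: eventually_mono\<close>)
  moreover have "w \<in> Lp 2 {a<..<b}"
    using assms(1) by (simp add: W12_repr_def)
  ultimately show ?thesis
    using W12_repr_has_weak_deriv[OF assms] unfolding sobolev_1 by blast
qed

lemma W12_repr_wderiv:
  assumes "W12_repr a b u U w" "a < b"
  shows "AE x in lebesgue_on {a<..<b}. wderiv {a<..<b} u x = w x"
    "wderiv {a<..<b} u \<in> borel_measurable (lebesgue_on {a<..<b})"
proof -
  note wd = W12_repr_has_weak_deriv[OF assms]
  show "AE x in lebesgue_on {a<..<b}. wderiv {a<..<b} u x = w x"
    by (rule wderiv_AE_eq[OF wd assms(2)])
  have "has_weak_deriv {a<..<b} u (wderiv {a<..<b} u)"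
    unfolding wderiv_def by (rule someI[of "has_weak_deriv {a<..<b} u" w]) (rule wd)
  then show "wderiv {a<..<b} u \<in> borel_measurable (lebesgue_on {a<..<b})"
    by (auto simp: has_weak_deriv_def intro: locally_integrable_measurable)
qed

lemma sobolev_W12_repr:
  assumes "u \<in> sobolev 1 2 {a<..<b}" "a < b"
  obtains U w where "W12_repr a b u U w"
proof -
  obtain w where w: "u \<in> Lp 2 {a<..<b}" "w \<in> Lp 2 {a<..<b}" "has_weak_deriv {a<..<b} u w"
    using assms(1) unfolding sobolev_1 by blast
  obtain U where "abs_cont_deriv a b U w" "AE x in lebesgue_on {a<..<b}. u x = U x"
    using has_weak_deriv_imp_abs_cont_deriv[OF w(3) Lp2_imp_integrable[OF w(2)] assms(2)] by metis
  then show thesis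
    using that[of U w] w by (auto simp: W12_repr_def Lp_def)
qed

lemma W12_repr_mult:
  assumes u: "W12_repr a b u U w" and v: "W12_repr a b v V z"
  shows "W12_repr a b (\<lambda>x. u x * v x) (\<lambda>x. U x * V x) (\<lambda>x. w x * V x + U x * z x)"
  unfolding W12_repr_def
proof (intro conjI)
  have U: "abs_cont_deriv a b U w" "w \<in> Lp 2 {a<..<b}" and V: "abs_cont_deriv a b V z" "z \<in> Lp 2 {a<..<b}"
    using u v by (auto simp: W12_repr_def)
  show "abs_cont_deriv a b (\<lambda>x. U x * V x) (\<lambda>x. w x * V x + U x * z x)"
    by (rule abs_cont_deriv_mult[OF U(1) V(1)])
  have "(\<lambda>x. V x * w x) \<in> Lp 2 {a<..<b}" "(\<lambda>x. U x * z x) \<in> Lp 2 {a<..<b}"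
    by (intro abs_cont_deriv_mult_Lp2[OF V(1) U(2)] abs_cont_deriv_mult_Lp2[OF U(1) V(2)])+
  from Lp2_add[OF this] show "(\<lambda>x. w x * V x + U x * z x) \<in> Lp 2 {a<..<b}"
    by (simp add: mult.commute)
  have "AE x in lebesgue_on {a<..<b}. u x = U x" "AE x in lebesgue_on {a<..<b}. v x = V x"
    using u v by (auto simp: W12_repr_def)
  then show "AE x in lebesgue_on {a<..<b}. u x * v x = U x * V x"
    by eventually_elim simp
qed (use u v in \<open>auto simp: W12_repr_def\<close>)

lemma W12_repr_diff:
  assumes u: "W12_repr a b u U w" and v: "W12_repr a b v V z"
  shows "W12_repr a b (\<lambda>x. u x - v x) (\<lambda>x. U x - V x) (\<lambda>x. w x - z x)"
  unfolding W12_repr_def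
proof (intro conjI)
  have "AE x in lebesgue_on {a<..<b}. u x = U x" "AE x in lebesgue_on {a<..<b}. v x = V x"
    using u v by (auto simp: W12_repr_def)
  then show "AE x in lebesgue_on {a<..<b}. u x - v x = U x - V x"
    by eventually_elim simp
qed (use u v in \<open>auto simp: W12_repr_def intro: abs_cont_deriv_diff_fun Lp2_diff\<close>)

text \<open>Stated for a function that is its own representative, because nonvanishing on the closed
  interval must concern the continuous function in order to bound the reciprocal.\<close>

lemma W12_repr_inverse:
  assumes u: "W12_repr a b U U w" and nz: "\<And>x. x \<in> {a..b} \<Longrightarrow> U x \<noteq> 0"
  shows "W12_repr a b (\<lambda>x. 1 / U x) (\<lambda>x. 1 / U x) (\<lambda>x. - w x / (U x)\<^sup>2)"
proof -
  have U: "abs_cont_deriv a b U w" "w \<in> Lp 2 {a<..<b}"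
    using u by (auto simp: W12_repr_def)
  have I: "abs_cont_deriv a b (\<lambda>x. 1 / U x) (\<lambda>x. - w x / (U x)\<^sup>2)"
    by (rule abs_cont_deriv_inverse[OF U(1)]) (rule nz)
  have "(\<lambda>x. 1 / U x * (1 / U x * (- 1 * w x))) \<in> Lp 2 {a<..<b}"
    by (intro abs_cont_deriv_mult_Lp2[OF I] Lp2_cmult U(2))
  then show ?thesis
    by (intro W12_repr_refl I) (simp_all add: power2_eq_square)
qed

lemma W12_repr_smooth:
  assumes "smooth u"
  shows "W12_repr a b u u (\<lambda>x. vector_derivative u (at x))"
  by (intro W12_repr_refl abs_cont_deriv_smooth[OF assms]
      abs_cont_deriv_Lp2[OF abs_cont_deriv_smooth[OF smooth_vector_derivative[OF assms]]])

text \<open>Inside the interval the two functions differ on an open null set, which is empty;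
  continuity extends the equality to the endpoints.\<close>

lemma AE_eq_continuous_imp_eq:
  fixes u v :: "real \<Rightarrow> complex"
  assumes "continuous_on {a..b} u" "continuous_on {a..b} v"
    and ae: "AE x in lebesgue_on {a<..<b}. u x = v x" and "a < b"
  shows "x \<in> {a..b} \<Longrightarrow> u x = v x"
proof -
  define S where "S = {x \<in> {a<..<b}. u x - v x \<in> - {0}}"
  have cont: "continuous_on {a..b} (\<lambda>x. u x - v x)"
    using assms by (intro continuous_intros)
  have "continuous_on {a<..<b} (\<lambda>x. u x - v x)"
    by (rule continuous_on_subset[OF cont]) auto
  then have "open S"
    unfolding S_def vimage_def[symmetric]
    using continuous_open_preimage[of "{a<..<b}" "\<lambda>x. u x - v x" "- {0}"]
    by (auto simp: vimage_def Int_def)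
  moreover have "negligible S"
  proof -
    have "AE x in lebesgue. x \<notin> S"
      using ae by (subst (asm) AE_restrict_space_iff) (auto simp: S_def elim: eventually_mono)
    moreover have "S \<in> sets lebesgue" using \<open>open S\<close> by simp
    ultimately show ?thesis
      by (simp add: negligible_iff_null_sets AE_iff_null_sets)
  qed
  ultimately have "S = {}"
    using open_not_negligible by blast
  then have "\<And>x. x \<in> {a<..<b} \<Longrightarrow> u x - v x = 0"
    by (auto simp: S_def)
  then show "u x = v x" if "x \<in> {a..b}" for x
    using continuous_constant_on_closure[of "{a<..<b}" "\<lambda>x. u x - v x" 0 x] cont that \<open>a < b\<close>
    by simp
qed

text \<open>Nonvanishing of f is a pointwise hypothesis, so f itself, and not a modification on a
  null set, has to be the primitive of its weak derivative.\<close>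

lemma continuous_W12_repr:
  assumes "u \<in> sobolev 1 2 {a<..<b}" "continuous_on {a..b} u" "a < b"
  obtains w where "W12_repr a b u u w"
proof -
  obtain U w where r: "W12_repr a b u U w"
    using sobolev_W12_repr[OF assms(1,3)] by metis
  then have U: "abs_cont_deriv a b U w" by (simp add: W12_repr_def)
  have eq: "u x = U x" if "x \<in> {a..b}" for x
    using AE_eq_continuous_imp_eq[OF assms(2) abs_cont_deriv_continuous[OF U] _ assms(3) that] r
    by (simp add: W12_repr_def)
  have "u x = u a + integral {a..x} w" if "x \<in> {a..b}" for x
    using eq[OF that] eq[of a] abs_cont_deriv_eq[OF U that] \<open>a < b\<close> by simp
  then have "abs_cont_deriv a b u w"
    using abs_cont_deriv_integrable[OF U] unfolding abs_cont_deriv_def by blast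
  then show thesis
    using that[of w] r by (simp add: W12_repr_def)
qed

section \<open>Mean-square estimates and membership in the closure of the test functions\<close>

lemma lebesgue_integral_Ioo_const:
  fixes c :: real
  assumes "a < b"
  shows "(LINT x|lebesgue_on {a<..<b}. c) = (b - a) * c"
  using assms by (simp add: measure_restrict_space)

text \<open>The Cauchy-Schwarz inequality against the constant 1, obtained from nonnegativity of the
  variance of |v| about its mean m.\<close>

lemma integral_norm_squared_le:
  assumes v: "v \<in> Lp 2 {a<..<b}" and "a < b"
  shows "(integral {a..b} (\<lambda>x. cmod (v x)))\<^sup>2 \<le> (b - a) * (LINT x|lebesgue_on {a<..<b}. (cmod (v x))\<^sup>2)"
proof -
  let ?M = "lebesgue_on {a<..<b}"
  define I where "I = (LINT x|?M. cmod (v x))"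
  define m where "m = I / (b - a)"
  have int: "integrable ?M (\<lambda>x. cmod (v x))" "integrable ?M (\<lambda>x. (cmod (v x))\<^sup>2)"
    using Lp2_imp_integrable[OF v] Lp2D(2)[OF v] by auto
  have Ieq: "I = integral {a..b} (\<lambda>x. cmod (v x))"
    unfolding I_def using lebesgue_integral_eq_integral[OF int(1)]
    by (simp add: integral_open_interval_real)
  have "0 \<le> (LINT x|?M. (cmod (v x) - m)\<^sup>2)" by simp
  also have "(\<lambda>x. (cmod (v x) - m)\<^sup>2) = (\<lambda>x. (cmod (v x))\<^sup>2 - 2 * m * cmod (v x) + m\<^sup>2)"
    by (auto simp: fun_eq_iff power2_diff)
  also have "(LINT x|?M. (cmod (v x))\<^sup>2 - 2 * m * cmod (v x) + m\<^sup>2)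
    = (LINT x|?M. (cmod (v x))\<^sup>2) - 2 * m * I + (b - a) * m\<^sup>2"
    using int integrable_const_lebesgue_on_Ioo[of a b "m\<^sup>2"] by (simp add: I_def lebesgue_integral_Ioo_const[OF \<open>a < b\<close>] del: lebesgue_integral_const)
  also have "\<dots> = (LINT x|?M. (cmod (v x))\<^sup>2) - I\<^sup>2 / (b - a)"
  proof -
    have "(b - a) * m\<^sup>2 = I\<^sup>2 / (b - a)" "m * I = I\<^sup>2 / (b - a)"
      using \<open>a < b\<close> by (simp_all add: m_def power2_eq_square)
    then show ?thesis by simp
  qed
  finally have "I\<^sup>2 \<le> (b - a) * (LINT x|?M. (cmod (v x))\<^sup>2)"
    using \<open>a < b\<close> by (simp add: field_simps)
  then show ?thesis by (simp add: Ieq)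
qed

text \<open>It suffices to approximate the derivative w: a mean-square approximant \<psi>, corrected
  by a multiple of \<rho> to mean zero, has a test function as its primitive. The correction is
  small because w has mean zero by the boundary values of u, and closeness of derivatives gives
  closeness of functions that agree at a.\<close>

lemma sobolev12_0I:
  assumes u: "abs_cont_deriv a b u w" and w: "w \<in> Lp 2 {a<..<b}"
    and "u a = 0" "u b = 0" "a < b"
  shows "u \<in> sobolev12_0 {a<..<b}"
proof -
  let ?M = "lebesgue_on {a<..<b}"
  let ?I = "\<lambda>v. LINT x|?M. (cmod (v x))\<^sup>2"
  note ru = W12_repr_refl[OF u w]
  have "\<exists>\<phi>\<in>test_fun {a<..<b}. sobolev_norm12 {a<..<b} (\<lambda>x. u x - \<phi> x) < e" if "e > 0" for e
  proof -
    obtain \<rho> where \<rho>: "\<rho> \<in> test_fun {a<..<b}" "integral {a..b} \<rho> = 1"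
      using test_fun_integral_one[OF \<open>a < b\<close>] by metis
    \<comment> \<open>The first factor is the loss in passing from w - \<psi> to v = w - \<theta>,
      the second the loss in passing from the square integral of v to the squared Sobolev norm.
      Hence \<delta> = e^2 / R.\<close>
    define R where "R = (2 + 2 * (b - a) * ?I \<rho>) * (1 + (b - a)\<^sup>2)"
    have R: "R > 0"
      using \<open>a < b\<close> by (auto simp: R_def intro!: mult_pos_pos add_pos_nonneg)
    define \<delta> where "\<delta> = e\<^sup>2 / R"
    have "\<delta> > 0" using that R by (simp add: \<delta>_def)
    then obtain \<psi> where \<psi>: "\<psi> \<in> test_fun {a<..<b}" "?I (\<lambda>x. w x - \<psi> x) < \<delta>"
      using Lp2_test_fun_approximable[OF \<open>a < b\<close> w] unfolding test_fun_approximable_def by meson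
    define m where "m = integral {a..b} \<psi>"
    define \<theta> where "\<theta> = (\<lambda>x. \<psi> x + - m * \<rho> x)"
    have \<theta>: "\<theta> \<in> test_fun {a<..<b}"
      unfolding \<theta>_def by (intro test_fun_add test_fun_mult \<psi>(1) \<rho>(1) \<open>a < b\<close> smooth_const)
    have L2: "\<psi> \<in> Lp 2 {a<..<b}" "\<rho> \<in> Lp 2 {a<..<b}" "\<theta> \<in> Lp 2 {a<..<b}"
      by (intro test_fun_Lp2 \<psi>(1) \<rho>(1) \<theta> \<open>a < b\<close>)+
    have hk: "\<psi> integrable_on {a..b}" "\<rho> integrable_on {a..b}" "w integrable_on {a..b}"
      using Lp2_imp_integrable[OF L2(1)] Lp2_imp_integrable[OF L2(2)] Lp2_imp_integrable[OF w]
      by (simp_all add: integrable_lebesgue_on_Ioo_iff absolutely_integrable_on_def)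
    have "integral {a..b} \<theta> = 0"
      unfolding \<theta>_def using hk \<rho>(2)
      by (subst Henstock_Kurzweil_Integration.integral_add)
        (auto simp: m_def intro!: integrable_neg integrable_on_mult_right)
    then have P: "(\<lambda>x. integral {a..x} \<theta>) \<in> test_fun {a<..<b}"
      by (intro test_fun_primitive \<theta> \<open>a < b\<close>)
    \<comment> \<open>Since w integrates to 0, the mean of \<psi> is minus the integral of the error
      w - \<psi>.\<close>
    have "(cmod m)\<^sup>2 \<le> (b - a) * ?I (\<lambda>x. w x - \<psi> x)"
    proof -
      have d: "(\<lambda>x. w x - \<psi> x) \<in> Lp 2 {a<..<b}" by (intro Lp2_diff w L2)
      have "integral {a..b} w = 0"
        using abs_cont_deriv_diff[OF u, of a b] assms by simp
      then have "m = - integral {a..b} (\<lambda>x. w x - \<psi> x)"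
        using hk by (simp add: Henstock_Kurzweil_Integration.integral_diff m_def)
      also have "cmod \<dots> \<le> integral {a..b} (\<lambda>x. cmod (w x - \<psi> x))"
        unfolding norm_minus_cancel using Lp2_imp_integrable[OF d]
        by (intro integral_norm_bound_integral)
          (auto simp: integrable_lebesgue_on_Ioo_iff absolutely_integrable_on_def)
      finally have "(cmod m)\<^sup>2 \<le> (integral {a..b} (\<lambda>x. cmod (w x - \<psi> x)))\<^sup>2"
        by (intro power_mono) auto
      then show ?thesis
        using integral_norm_squared_le[OF d \<open>a < b\<close>] by linarith
    qed
    also have "\<dots> \<le> (b - a) * \<delta>"
      using \<psi>(2) \<open>a < b\<close> by (intro mult_left_mono) auto
    finally have m: "(cmod m)\<^sup>2 \<le> (b - a) * \<delta>" .
    define v where "v = (\<lambda>x. w x - \<theta> x)"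
    have v: "v \<in> Lp 2 {a<..<b}" unfolding v_def by (intro Lp2_diff w L2)
    have "?I v \<le> 2 * ?I (\<lambda>x. w x - \<psi> x) + 2 * ?I (\<lambda>x. m * \<rho> x)"
      using integral_norm_add_squared_le[OF Lp2_diff[OF w L2(1)] Lp2_cmult[OF L2(2), of m]]
      by (simp add: v_def \<theta>_def algebra_simps)
    also have "?I (\<lambda>x. m * \<rho> x) = (cmod m)\<^sup>2 * ?I \<rho>"
      by (simp add: norm_mult power_mult_distrib)
    also have "\<dots> \<le> (b - a) * \<delta> * ?I \<rho>"
      by (intro mult_right_mono m) simp
    finally have "?I v < 2 * \<delta> + 2 * ((b - a) * \<delta> * ?I \<rho>)"
      using \<psi>(2) by linarith
    also have "\<dots> = (2 + 2 * (b - a) * ?I \<rho>) * \<delta>"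
      by (simp add: algebra_simps)
    finally have Iv: "?I v < (2 + 2 * (b - a) * ?I \<rho>) * \<delta>" .
    define \<Phi> where "\<Phi> = (\<lambda>x. integral {a..x} \<theta>)"
    have \<Phi>': "abs_cont_deriv a b \<Phi> \<theta>"
      unfolding \<Phi>_def using Lp2_imp_integrable[OF L2(3)]
      by (intro abs_cont_deriv_primitive) (simp add: integrable_lebesgue_on_Ioo_iff)
    note r = W12_repr_diff[OF ru W12_repr_refl[OF \<Phi>' L2(3)], folded v_def]
    have acd: "abs_cont_deriv a b (\<lambda>x. u x - \<Phi> x) v"
      using r by (simp add: W12_repr_def)
    \<comment> \<open>The difference vanishes at a, so it is the integral of v from a to x.\<close>
    have pt: "(cmod (u x - \<Phi> x))\<^sup>2 \<le> (b - a) * ?I v" if "x \<in> {a<..<b}" for x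
    proof -
      have "u x - \<Phi> x = integral {a..x} v"
        using abs_cont_deriv_eq[OF acd, of x] that \<open>u a = 0\<close> by (simp add: \<Phi>_def)
      also have "cmod \<dots> \<le> integral {a..x} (\<lambda>t. cmod (v t))"
        using abs_cont_deriv_integrable_sub[OF acd, of a x] that
        by (intro integral_norm_bound_integral) auto
      also have "\<dots> \<le> integral {a..b} (\<lambda>t. cmod (v t))"
        using abs_cont_deriv_integrable_sub[OF acd, of a x] abs_cont_deriv_integrable_sub[OF acd, of a b] that
        by (intro integral_subset_le) auto
      finally have "(cmod (u x - \<Phi> x))\<^sup>2 \<le> (integral {a..b} (\<lambda>t. cmod (v t)))\<^sup>2"
        by (intro power_mono) auto
      then show ?thesis
        using integral_norm_squared_le[OF v \<open>a < b\<close>] by linarith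
    qed
    have "?I (\<lambda>x. u x - \<Phi> x) \<le> (LINT x|?M. (b - a) * ?I v)"
      by (intro integral_mono integrable_const_lebesgue_on_Ioo Lp2D(2)[OF abs_cont_deriv_Lp2[OF acd]])
        (use pt in auto)
    also have "\<dots> = (b - a)\<^sup>2 * ?I v"
      using \<open>a < b\<close> by (subst lebesgue_integral_Ioo_const) (auto simp: power2_eq_square)
    finally have I1: "?I (\<lambda>x. u x - \<Phi> x) \<le> (b - a)\<^sup>2 * ?I v" .
    have I2: "?I (wderiv {a<..<b} (\<lambda>x. u x - \<Phi> x)) = ?I v"
      by (rule integral_cong_AE)
        (use W12_repr_wderiv[OF r \<open>a < b\<close>] Lp2D(1)[OF v] in \<open>auto elim: eventually_mono\<close>)
    have "?I (\<lambda>x. u x - \<Phi> x) + ?I (wderiv {a<..<b} (\<lambda>x. u x - \<Phi> x)) \<le> (1 + (b - a)\<^sup>2) * ?I v"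
      using I1 I2 by (simp add: algebra_simps)
    also have "\<dots> < (1 + (b - a)\<^sup>2) * ((2 + 2 * (b - a) * ?I \<rho>) * \<delta>)"
      by (intro mult_strict_left_mono Iv add_pos_nonneg) auto
    also have "\<dots> = R * \<delta>"
      by (simp add: R_def mult_ac)
    also have "\<dots> = e\<^sup>2"
      using R by (simp add: \<delta>_def)
    finally have "sobolev_norm12 {a<..<b} (\<lambda>x. u x - \<Phi> x) < e"
      using that unfolding sobolev_norm12_def by (intro real_less_lsqrt) auto
    then show ?thesis using P unfolding \<Phi>_def by (rule bexI)
  qed
  then show ?thesis
    using W12_repr_sobolev[OF ru \<open>a < b\<close>] by (simp add: sobolev12_0_def)
qed

section \<open>The factorization\<close>

text \<open>With q = p / f both integrands equal (y' - q Y)(\<phi>' - q \<Phi>) wherever the weak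
  derivatives take their chosen values; distributing one f between the factors gives the form on the
  right.\<close>

lemma schroedinger_eq_factorized:
  assumes f: "W12_repr a b f f p" and nz: "\<And>x. x \<in> {a..b} \<Longrightarrow> f x \<noteq> 0"
    and y: "W12_repr a b y Y y'" and \<phi>: "W12_repr a b \<phi> \<Phi> \<phi>'" and "a < b"
  shows "schroedinger {a<..<b} f y \<phi>
    = (LINT x|lebesgue_on {a<..<b}. (f x * y' x - p x * Y x) * (\<phi>' x / f x - p x * \<Phi> x / (f x)\<^sup>2))"
proof -
  let ?J = "{a<..<b}"
  let ?M = "lebesgue_on {a<..<b}"
  have nzJ: "f x \<noteq> 0" if "x \<in> ?J" for x using nz that by auto
  have fc: "abs_cont_deriv a b f p" "p \<in> Lp 2 ?J" "f \<in> borel_measurable ?M"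
    and yc: "abs_cont_deriv a b Y y'" "y' \<in> Lp 2 ?J" "AE x in ?M. y x = Y x" "y \<in> borel_measurable ?M"
    and \<phi>c: "abs_cont_deriv a b \<Phi> \<phi>'" "\<phi>' \<in> Lp 2 ?J" "AE x in ?M. \<phi> x = \<Phi> x" "\<phi> \<in> borel_measurable ?M"
    using f y \<phi> by (auto simp: W12_repr_def)
  have inv: "abs_cont_deriv a b (\<lambda>x. 1 / f x) (\<lambda>x. - p x / (f x)\<^sup>2)"
    by (rule abs_cont_deriv_inverse[OF fc(1)]) (rule nz)
  note m = fc(3) yc(4) \<phi>c(4) abs_cont_deriv_measurable[OF yc(1)] abs_cont_deriv_measurable[OF \<phi>c(1)]
    fc(2)[THEN Lp2D(1)] yc(2)[THEN Lp2D(1)] \<phi>c(2)[THEN Lp2D(1)]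
  note y\<phi> = W12_repr_mult[OF y \<phi>]
  note wf = W12_repr_wderiv[OF f \<open>a < b\<close>] and wy = W12_repr_wderiv[OF y \<open>a < b\<close>]
    and w\<phi> = W12_repr_wderiv[OF \<phi> \<open>a < b\<close>] and wy\<phi> = W12_repr_wderiv[OF y\<phi> \<open>a < b\<close>]
  have A: "(LINT x|?M. wderiv ?J y x * wderiv ?J \<phi> x) = (LINT x|?M. y' x * \<phi>' x)"
  proof (rule integral_cong_AE)
    show "AE x in ?M. wderiv ?J y x * wderiv ?J \<phi> x = y' x * \<phi>' x"
      using wy(1) w\<phi>(1) by eventually_elim simp
  qed (use m wy(2) w\<phi>(2) in auto)
  \<comment> \<open>The integrand of \<open>q_dist\<close> at y \<phi>, after the product rule for y
    \<phi> and passage to representatives.\<close>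
  define B where "B = (\<lambda>x. (p x / f x)\<^sup>2 * (Y x * \<Phi> x) - p x / f x * (y' x * \<Phi> x + Y x * \<phi>' x))"
  have Bm: "B \<in> borel_measurable ?M" unfolding B_def using m by measurable
  have B: "q_dist ?J f (\<lambda>x. y x * \<phi> x) = (LINT x|?M. B x)"
    unfolding q_dist_def
  proof (rule integral_cong_AE)
    show "AE x in ?M. (wderiv ?J f x / f x)\<^sup>2 * (y x * \<phi> x)
        - wderiv ?J f x / f x * wderiv ?J (\<lambda>x. y x * \<phi> x) x = B x"
      using wf(1) wy\<phi>(1) yc(3) \<phi>c(3) by eventually_elim (simp add: B_def)
    show "(\<lambda>x. (wderiv ?J f x / f x)\<^sup>2 * (y x * \<phi> x)
        - wderiv ?J f x / f x * wderiv ?J (\<lambda>x. y x * \<phi> x) x) \<in> borel_measurable ?M"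
      using m wf(2) wy\<phi>(2) by measurable
  qed (rule Bm)
  have intA: "integrable ?M (\<lambda>x. y' x * \<phi>' x)"
    by (intro Lp2_mult_integrable yc \<phi>c)
  \<comment> \<open>Merging the two integrals of \<open>schroedinger\<close> requires each to be
    integrable. The term q^2 Y \<Phi> is the product of the square-integrable functions Y q and
    \<Phi> q; the remaining one is q times the derivative of Y \<Phi>.\<close>
  have intB: "integrable ?M B"
  proof -
    have q: "(\<lambda>x. 1 / f x * p x) \<in> Lp 2 ?J"
      by (intro abs_cont_deriv_mult_Lp2[OF inv] fc)
    have "(\<lambda>x. \<Phi> x * y' x) \<in> Lp 2 ?J" "(\<lambda>x. Y x * \<phi>' x) \<in> Lp 2 ?J"
      by (intro abs_cont_deriv_mult_Lp2[OF \<phi>c(1)] abs_cont_deriv_mult_Lp2[OF yc(1)] yc \<phi>c)+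
    note s = Lp2_add[OF this]
    have "(\<lambda>x. Y x * (1 / f x * p x)) \<in> Lp 2 ?J" "(\<lambda>x. \<Phi> x * (1 / f x * p x)) \<in> Lp 2 ?J"
      by (intro abs_cont_deriv_mult_Lp2[OF \<phi>c(1)] abs_cont_deriv_mult_Lp2[OF yc(1)] q)+
    from Bochner_Integration.integrable_diff[OF Lp2_mult_integrable[OF this] Lp2_mult_integrable[OF q s]]
    show ?thesis
      by (simp add: B_def power2_eq_square mult_ac)
  qed
  have "schroedinger ?J f y \<phi> = (LINT x|?M. y' x * \<phi>' x + B x)"
    using intA intB by (simp add: schroedinger_def A B)
  also have "\<dots> = (LINT x|?M. (f x * y' x - p x * Y x) * (\<phi>' x / f x - p x * \<Phi> x / (f x)\<^sup>2))"
  proof (rule Bochner_Integration.integral_cong[OF refl])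
    fix x assume "x \<in> space ?M"
    then have "f x \<noteq> 0" using nzJ by simp
    then show "y' x * \<phi>' x + B x = (f x * y' x - p x * Y x) * (\<phi>' x / f x - p x * \<Phi> x / (f x)\<^sup>2)"
      by (simp add: B_def field_simps power2_eq_square)
  qed
  finally show ?thesis .
qed

text \<open>Multiplying a distribution by 1/f means acting on \<phi>/f, which gives the first
  conjunct its form. Membership in \<open>sobolev 2 1 J\<close> places y/f in the domain of the
  impedance operator, and the third conjunct identifies the regular representative of
  \<open>S_f y\<close>. Continuity of f on the closed interval selects the representative to which
  the pointwise conditions refer.\<close>

theorem theorem6:
  fixes a b x0 :: real and J :: "real set" and f :: "real \<Rightarrow> complex"
  assumes "a < b" and "J = {a<..<b}" and "x0 \<in> closure J"
    and "f \<in> sobolev 1 2 J"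
    and "continuous_on (closure J) f"
    and "\<forall>x\<in>closure J. f x \<noteq> 0"
    and "f x0 = 1"
  shows "\<forall>y\<in>domain2 J f.
      dist_eq J (schroedinger J f y)
        (\<lambda>\<phi>. - dist_mult (\<lambda>x. 1 / f x)
                 (dist_deriv J (\<lambda>x. (f x)\<^sup>2 * wderiv J (\<lambda>t. y t / f t) x)) \<phi>) \<and>
      (\<lambda>x. y x / f x) \<in> sobolev 2 1 J \<and>
      L2_regular J (schroedinger J f y) (\<lambda>x. f x * impedance J f (\<lambda>t. y t / f t) x)"
proof
  fix y assume y: "y \<in> domain2 J f"
  note J = \<open>J = {a<..<b}\<close> and ab = \<open>a < b\<close>
  let ?M = "lebesgue_on {a<..<b}"
  have cl: "closure J = {a..b}" using ab by (simp add: J)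
  have nz: "f x \<noteq> 0" if "x \<in> {a..b}" for x using assms(6) that cl by auto
  have nzJ: "f x \<noteq> 0" if "x \<in> {a<..<b}" for x using nz that by auto
  obtain p where f: "W12_repr a b f f p"
    using continuous_W12_repr[of f a b] assms(4,5) ab J cl by metis
  have fc: "abs_cont_deriv a b f p" "p \<in> Lp 2 {a<..<b}" "f \<in> borel_measurable ?M"
    using f by (auto simp: W12_repr_def)
  obtain Y y' where Y: "W12_repr a b y Y y'"
    using sobolev_W12_repr[of y a b] y ab by (auto simp: domain2_def J)
  have yc: "abs_cont_deriv a b Y y'" "y' \<in> Lp 2 {a<..<b}" "AE x in ?M. y x = Y x" "y \<in> borel_measurable ?M"
    using Y by (auto simp: W12_repr_def)
  obtain g where "L2_regular J (schroedinger J f y) g"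
    using y by (auto simp: domain2_def)
  then have g: "g \<in> Lp 2 {a<..<b}"
    and Sg: "\<And>\<phi>. \<phi> \<in> sobolev12_0 {a<..<b} \<Longrightarrow> schroedinger J f y \<phi> = (LINT x|?M. g x * \<phi> x)"
    by (auto simp: L2_regular_def dist_eq_def dist_of_fun_def J)
  have inv: "W12_repr a b (\<lambda>x. 1 / f x) (\<lambda>x. 1 / f x) (\<lambda>x. - p x / (f x)\<^sup>2)"
    by (rule W12_repr_inverse[OF f]) (rule nz)
  let ?v = "\<lambda>t. y t / f t"
  define v' where "v' = (\<lambda>x. y' x * (1 / f x) + Y x * (- p x / (f x)\<^sup>2))"
  have v: "W12_repr a b ?v (\<lambda>x. Y x * (1 / f x)) v'"
    using W12_repr_mult[OF Y inv] by (simp add: v'_def)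
  note wv = W12_repr_wderiv[OF v ab, folded J]
  define h where "h = (\<lambda>x. (f x)\<^sup>2 * wderiv J ?v x)"
  \<comment> \<open>While h contains the unspecified choice \<open>wderiv\<close>, h0 is an explicit
    expression in representatives. Calculations are done with h0 and transferred to h by
    \<open>hh0\<close>.\<close>
  define h0 where "h0 = (\<lambda>x. f x * y' x - p x * Y x)"
  have h0_eq: "(f x)\<^sup>2 * v' x = h0 x" if "x \<in> {a<..<b}" for x
    using nzJ[OF that] by (simp add: h0_def v'_def field_simps power2_eq_square)
  have hm: "h \<in> borel_measurable ?M"
    unfolding h_def using fc(3) wv(2) by (simp add: J)
  have "AE x in ?M. x \<in> {a<..<b}" by (intro AE_I2) simp
  with wv(1) have hh0: "AE x in ?M. h x = h0 x"
    unfolding J by eventually_elim (simp add: h_def h0_eq J)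
  have h0: "h0 \<in> Lp 2 {a<..<b}"
  proof -
    have "(\<lambda>x. f x * y' x) \<in> Lp 2 {a<..<b}" "(\<lambda>x. Y x * p x) \<in> Lp 2 {a<..<b}"
      by (intro abs_cont_deriv_mult_Lp2[OF fc(1)] abs_cont_deriv_mult_Lp2[OF yc(1)] fc yc)+
    from Lp2_diff[OF this] show ?thesis by (simp add: h0_def mult.commute)
  qed
  have gf: "(\<lambda>x. - (g x * f x)) \<in> Lp 2 {a<..<b}"
    using Lp2_cmult[OF abs_cont_deriv_mult_Lp2[OF fc(1) g], of "-1"] by (simp add: mult.commute)

  have S_eq: "schroedinger {a<..<b} f y \<phi>
      = (LINT x|?M. h0 x * (\<phi>' x / f x - p x * \<Phi> x / (f x)\<^sup>2))"
    if "W12_repr a b \<phi> \<Phi> \<phi>'" for \<phi> \<Phi> \<phi>'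
    unfolding h0_def by (rule schroedinger_eq_factorized[OF f _ Y that ab]) (rule nz)
  have factorized: "dist_eq J (schroedinger J f y)
        (\<lambda>\<phi>. - dist_mult (\<lambda>x. 1 / f x) (dist_deriv J h) \<phi>)"
    unfolding dist_eq_def
  proof
    fix \<phi> assume "\<phi> \<in> sobolev12_0 J"
    then obtain \<Phi> \<phi>' where \<phi>: "W12_repr a b \<phi> \<Phi> \<phi>'"
      using sobolev_W12_repr[of \<phi> a b] ab by (auto simp: sobolev12_0_def J)
    note \<phi>f = W12_repr_mult[OF inv \<phi>]
    have \<phi>c: "\<phi>' \<in> Lp 2 {a<..<b}" "\<Phi> \<in> borel_measurable ?M"
      using \<phi> abs_cont_deriv_measurable by (auto simp: W12_repr_def)
    \<comment> \<open>The minus sign inside \<open>dist_deriv\<close> cancels the leading one of the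
      factorization, leaving this integral.\<close>
    have "(LINT x|?M. h x * wderiv {a<..<b} (\<lambda>x. 1 / f x * \<phi> x) x)
      = (LINT x|?M. h0 x * (\<phi>' x / f x - p x * \<Phi> x / (f x)\<^sup>2))"
    proof (rule integral_cong_AE)
      show "AE x in ?M. h x * wderiv {a<..<b} (\<lambda>x. 1 / f x * \<phi> x) x
          = h0 x * (\<phi>' x / f x - p x * \<Phi> x / (f x)\<^sup>2)"
        using hh0 W12_repr_wderiv(1)[OF \<phi>f ab]
      proof eventually_elim
        case (elim x)
        have "- p x / (f x)\<^sup>2 * \<Phi> x + 1 / f x * \<phi>' x = \<phi>' x / f x - p x * \<Phi> x / (f x)\<^sup>2"
          by simp
        with elim show ?case by (simp only:)
      qed
      show "(\<lambda>x. h x * wderiv {a<..<b} (\<lambda>x. 1 / f x * \<phi> x) x) \<in> borel_measurable ?M"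
        using hm W12_repr_wderiv(2)[OF \<phi>f ab] by simp
      show "(\<lambda>x. h0 x * (\<phi>' x / f x - p x * \<Phi> x / (f x)\<^sup>2)) \<in> borel_measurable ?M"
        using Lp2D(1)[OF h0] Lp2D(1)[OF \<phi>c(1)] \<phi>c(2) Lp2D(1)[OF fc(2)] fc(3) by measurable
    qed
    then show "schroedinger J f y \<phi> = - dist_mult (\<lambda>x. 1 / f x) (dist_deriv J h) \<phi>"
      using S_eq[OF \<phi>] by (simp add: dist_mult_def dist_deriv_def J)
  qed

  have wh0: "has_weak_deriv {a<..<b} h0 (\<lambda>x. - (g x * f x))"
    unfolding has_weak_deriv_def
  proof (intro conjI ballI)
    show "locally_integrable {a<..<b} h0" "locally_integrable {a<..<b} (\<lambda>x. - (g x * f x))"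
      by (intro integrable_imp_locally_integrable Lp2_imp_integrable h0 gf; simp)+
    fix \<psi> assume \<psi>: "\<psi> \<in> test_fun {a<..<b}"
    let ?\<psi>' = "\<lambda>x. vector_derivative \<psi> (at x)"
    obtain c d where cd: "a < c" "c \<le> d" "d < b" "\<And>x. \<psi> x \<noteq> 0 \<Longrightarrow> x \<in> {c..d}"
      using test_fun_support[OF \<psi> ab] by metis
    have \<psi>0: "\<psi> a = 0" "\<psi> b = 0" using cd(1-3) cd(4)[of a] cd(4)[of b] by auto
    note f\<psi> = W12_repr_mult[OF f W12_repr_smooth[OF test_fun_smooth[OF \<psi>]]]
    have "(\<lambda>x. f x * \<psi> x) \<in> sobolev12_0 {a<..<b}"
      by (rule sobolev12_0I[where w = "\<lambda>x. p x * \<psi> x + f x * ?\<psi>' x"])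
        (use f\<psi> \<psi>0 ab in \<open>auto simp: W12_repr_def\<close>)
    then have "(LINT x|?M. g x * (f x * \<psi> x)) = schroedinger {a<..<b} f y (\<lambda>x. f x * \<psi> x)"
      using Sg by (simp add: J)
    also have "\<dots> = (LINT x|?M. h0 x * ?\<psi>' x)"
      unfolding S_eq[OF f\<psi>]
    proof (rule Bochner_Integration.integral_cong[OF refl])
      fix x assume "x \<in> space ?M"
      then have "f x \<noteq> 0" using nzJ by simp
      then have "(p x * \<psi> x + f x * ?\<psi>' x) / f x - p x * (f x * \<psi> x) / (f x)\<^sup>2 = ?\<psi>' x"
        by (simp add: field_simps power2_eq_square)
      then show "h0 x * ((p x * \<psi> x + f x * ?\<psi>' x) / f x - p x * (f x * \<psi> x) / (f x)\<^sup>2)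
          = h0 x * ?\<psi>' x"
        by simp
    qed
    finally show "(LINT x|?M. h0 x * ?\<psi>' x) = - (LINT x|?M. - (g x * f x) * \<psi> x)"
      by (simp add: mult.assoc)
  qed

  have sob: "?v \<in> sobolev 2 1 J"
  proof -
    \<comment> \<open>The weak derivative of h0 is square integrable, so h0 has an absolutely
      continuous representative and can be multiplied by 1/f twice within the Sobolev space.\<close>
    obtain H where H: "abs_cont_deriv a b H (\<lambda>x. - (g x * f x))" "AE x in ?M. h0 x = H x"
      using has_weak_deriv_imp_abs_cont_deriv[OF wh0 Lp2_imp_integrable[OF gf] ab] by metis
    have rH: "W12_repr a b h0 H (\<lambda>x. - (g x * f x))"
      using H gf Lp2D(1)[OF h0] by (simp add: W12_repr_def)
    \<comment> \<open>The derivative h0 / f^2 of y/f, written as a product so that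
      \<open>W12_repr_mult\<close> applies. The exponent drops from 2 to 1 because the interval is
      bounded.\<close>
    define z where "z = (\<lambda>x. h0 x * (1 / f x * (1 / f x)))"
    have "z \<in> sobolev 1 2 {a<..<b}"
      unfolding z_def by (rule W12_repr_sobolev[OF W12_repr_mult[OF rH W12_repr_mult[OF inv inv]] ab])
    then have z: "z \<in> sobolev 1 1 {a<..<b}"
      unfolding sobolev_1 using Lp2_imp_Lp1 by blast
    have zv: "v' x = z x" if "x \<in> {a<..<b}" for x
      using nzJ[OF that] h0_eq[OF that, symmetric] by (simp add: z_def field_simps power2_eq_square)
    have vL: "?v \<in> sobolev 1 2 {a<..<b}" by (rule W12_repr_sobolev[OF v ab])
    have "has_weak_deriv {a<..<b} ?v z"
    proof (rule has_weak_deriv_cong_AE[OF W12_repr_has_weak_deriv[OF v ab]])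
      show "?v \<in> borel_measurable ?M" using v by (simp add: W12_repr_def)
      show "z \<in> borel_measurable ?M" using z unfolding sobolev_1 Lp_def by blast
      show "AE x in ?M. v' x = z x" using zv by (intro AE_I2) simp
    qed (use ab in auto)
    moreover have "?v \<in> Lp 1 {a<..<b}"
      using vL Lp2_imp_Lp1 unfolding sobolev_1 by blast
    ultimately show ?thesis
      using z by (auto simp: numeral_2_eq_2 J)
  qed

  have wh: "has_weak_deriv {a<..<b} h (\<lambda>x. - (g x * f x))"
    by (rule has_weak_deriv_cong_AE[OF wh0 hm _ Lp2D(1)[OF gf] _ ab])
      (use hh0 in \<open>auto elim: eventually_mono\<close>)
  define G where "G = (\<lambda>x. f x * impedance J f ?v x)"
  have whm: "wderiv {a<..<b} h \<in> borel_measurable ?M"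
  proof -
    have "has_weak_deriv {a<..<b} h (wderiv {a<..<b} h)"
      unfolding wderiv_def by (rule someI[of "has_weak_deriv {a<..<b} h"]) (rule wh)
    then show ?thesis by (auto simp: has_weak_deriv_def intro: locally_integrable_measurable)
  qed
  have G_def': "G = (\<lambda>x. f x * (- (1 / (f x)\<^sup>2) * wderiv {a<..<b} h x))"
    by (simp add: G_def impedance_def h_def J)
  have Gm: "G \<in> borel_measurable ?M"
    unfolding G_def' using fc(3) whm by measurable
  have "AE x in ?M. x \<in> {a<..<b}" by (intro AE_I2) simp
  \<comment> \<open>Almost everywhere the weak derivative of h is -g f, and f times -1/f^2 times -g
    f is g.\<close>
  with wderiv_AE_eq[OF wh ab] have Gg: "AE x in ?M. g x = G x"
  proof eventually_elim
    case (elim x)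
    then show ?case using nzJ[of x] by (simp add: G_def' field_simps power2_eq_square)
  qed
  have "L2_regular J (schroedinger J f y) G"
    unfolding L2_regular_def dist_eq_def dist_of_fun_def
  proof (intro conjI ballI)
    show "G \<in> Lp 2 J" unfolding J by (rule Lp2_cong_AE[OF g Gm Gg])
    fix \<phi> assume \<phi>: "\<phi> \<in> sobolev12_0 J"
    then have "\<phi> \<in> borel_measurable ?M"
      by (auto simp: sobolev12_0_def Lp_def J)
    then have "(LINT x|?M. g x * \<phi> x) = (LINT x|?M. G x * \<phi> x)"
      by (intro integral_cong_AE) (use Gg Gm Lp2D(1)[OF g] in \<open>auto elim: eventually_mono\<close>)
    then show "schroedinger J f y \<phi> = (LINT x|lebesgue_on J. G x * \<phi> x)"
      using Sg \<phi> by (simp add: J)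
  qed
  with factorized sob show "dist_eq J (schroedinger J f y)
        (\<lambda>\<phi>. - dist_mult (\<lambda>x. 1 / f x)
                 (dist_deriv J (\<lambda>x. (f x)\<^sup>2 * wderiv J (\<lambda>t. y t / f t) x)) \<phi>) \<and>
      (\<lambda>x. y x / f x) \<in> sobolev 2 1 J \<and>
      L2_regular J (schroedinger J f y) (\<lambda>x. f x * impedance J f (\<lambda>t. y t / f t) x)"
    by (simp add: h_def G_def)
qed

end
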